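(* Assume that $p_0$ is a density on $\mathbb{R}^d$ with $p_0\in\mathcal{W}^{s,2}$ and $\|p_0\|_{\mathcal{W}^{s,2}}<M$, and that $(\Delta_n)$ is a sequence of positive numbers with $\liminf_{n\to\infty}n^{2s/(d+4s)}\Delta_n<\infty$. Then there exists some $\alpha\in(0,1)$ such that for any test $\Phi_n$ of level $\alpha$ (asymptotically) based on $X_1,\ldots,X_n\sim_{\rm iid}p$, $$\liminf_{n\to\infty}{\rm power}\{\Phi_n;H_1^{\rm GOF}(\Delta_n;s)\}<1.$$
   Context: Fix $d\ge1$, $s>0$, $M>0$. For $f:\mathbb{R}^d\to\mathbb{R}$ let $\mathcal{F}(f)(\omega)=(2\pi)^{-d/2}\int f(x)e^{-ix^\top\omega}dx$ be its Fourier transform, $\|f\|_{L_2}^2=\int f^2$, and $\|f\|_{\mathcal{W}^{s,2}}^2=\int(1+\|\omega\|^2)^s|\mathcal{F}(f)(\omega)|^2d\omega$. $\mathcal{W}^{s,2}$ is the set of $f:\mathbb{R}^d\to\mathbb{R}$ that are almost everywhere continuous with $\|f\|_{\mathcal{W}^{s,2}}<\infty$, and $\mathcal{W}^{s,2}(M)=\{f\in\mathcal{W}^{s,2}:\|f\|_{\mathcal{W}^{s,2}}\le M\}$. One observes $X_1,\dots,X_n$ i.i.d. with density $p$. The null hypothesis is $H_0^{\rm GOF}:p=p_0$; the alternative $H_1^{\rm GOF}(\Delta_n;s)$ is: $p\in\mathcal{W}^{s,2}(M)$ is a density with $\|p-p_0\|_{L_2}\ge\Delta_n$. The power of a test $\Phi$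 is $${\rm power}\{\Phi;H_1^{\rm GOF}(\Delta_n;s)\}=\inf_{p\in\mathcal{W}^{s,2}(M),\ \|p-p_0\|_{L_2}\ge\Delta_n}\mathbb{P}\{\Phi\text{ rejects }H_0^{\rm GOF}\},$$ the probability being under $X_1,\dots,X_n\sim_{\rm iid}p$. A sequence of tests $\Phi_n$ has (asymptotic) level $\alpha$ if the limsup, as $n\to\infty$, of the probability that $\Phi_n$ rejects $H_0^{\rm GOF}$ when $p=p_0$ is at most $\alpha$. *)

theory Defs
  imports "HOL-Probability.Probability"
begin

definition fourier :: "('a::euclidean_space \<Rightarrow> real) \<Rightarrow> 'a \<Rightarrow> complex" where
  "fourier f \<omega> = complex_of_real ((2 * pi) powr (- real DIM('a) / 2)) *
     (LINT x|lborel. complex_of_real (f x) * exp (- (\<i> * complex_of_real (x \<bullet> \<omega>))))"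

definition esqrt :: "ennreal \<Rightarrow> ennreal" where
  "esqrt x = (if x = \<infinity> then \<infinity> else ennreal (sqrt (enn2real x)))"

text \<open>Both norms take values in the extended nonnegative reals, so that an infinite norm is
  represented as such.\<close>

definition L2_enorm :: "('a::euclidean_space \<Rightarrow> real) \<Rightarrow> ennreal" where
  "L2_enorm f = esqrt (\<integral>\<^sup>+ x. ennreal ((f x)\<^sup>2) \<partial>lborel)"

definition sobolev_enorm :: "real \<Rightarrow> ('a::euclidean_space \<Rightarrow> real) \<Rightarrow> ennreal" where
  "sobolev_enorm s f =
     esqrt (\<integral>\<^sup>+ \<omega>. ennreal ((1 + (norm \<omega>)\<^sup>2) powr s * (cmod (fourier f \<omega>))\<^sup>2) \<partial>lborel)"

text \<open>The integral defining the Fourier transform makes sense for integrable functions only; the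
  Bochner integral of a non-integrable function is 0 by convention, so without the integrability
  condition every a.e. continuous non-integrable function would belong to the space. The
  condition is no restriction for densities.\<close>

definition sobolev :: "real \<Rightarrow> ('a::euclidean_space \<Rightarrow> real) set" where
  "sobolev s = {f. integrable lborel f \<and> (AE x in lborel. isCont f x) \<and> sobolev_enorm s f < \<infinity>}"

definition sobolev_ball :: "real \<Rightarrow> real \<Rightarrow> ('a::euclidean_space \<Rightarrow> real) set" where
  "sobolev_ball s M = {f \<in> sobolev s. sobolev_enorm s f \<le> ennreal M}"

definition prob_density :: "('a::euclidean_space \<Rightarrow> real) \<Rightarrow> bool" where
  "prob_density p \<longleftrightarrow>
     p \<in> borel_measurable borel \<and> (\<forall>x. 0 \<le> p x) \<and> (\<integral>\<^sup>+ x. ennreal (p x) \<partial>lborel) = 1"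

definition sample_law :: "nat \<Rightarrow> ('a::euclidean_space \<Rightarrow> real) \<Rightarrow> (nat \<Rightarrow> 'a) measure" where
  "sample_law n p = (\<Pi>\<^sub>M i\<in>{..<n}. density lborel (\<lambda>x. ennreal (p x)))"

text \<open>A test based on a sample of size \<open>n\<close> is a measurable decision (\<open>True\<close> meaning rejection)
  depending on the sample only.\<close>

definition is_test :: "nat \<Rightarrow> ((nat \<Rightarrow> 'a::euclidean_space) \<Rightarrow> bool) \<Rightarrow> bool" where
  "is_test n \<phi> \<longleftrightarrow> \<phi> \<in> measurable (\<Pi>\<^sub>M i\<in>{..<n}. borel) (count_space UNIV)"

definition reject_prob ::
  "nat \<Rightarrow> ((nat \<Rightarrow> 'a::euclidean_space) \<Rightarrow> bool) \<Rightarrow> ('a \<Rightarrow> real) \<Rightarrow> real" where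
  "reject_prob n \<phi> p = measure (sample_law n p) {x \<in> space (sample_law n p). \<phi> x}"

definition gof_alternative ::
  "real \<Rightarrow> real \<Rightarrow> ('a::euclidean_space \<Rightarrow> real) \<Rightarrow> real \<Rightarrow> ('a \<Rightarrow> real) set" where
  "gof_alternative s M p0 \<Delta> =
     {p \<in> sobolev_ball s M. prob_density p \<and> L2_enorm (\<lambda>x. p x - p0 x) \<ge> ennreal \<Delta>}"

text \<open>Taken in the extended reals, so that the infimum over an empty alternative is \<open>\<infinity>\<close>
  and not an unspecified real number.\<close>

definition gof_power ::
  "nat \<Rightarrow> ((nat \<Rightarrow> 'a::euclidean_space) \<Rightarrow> bool) \<Rightarrow> ('a \<Rightarrow> real) set \<Rightarrow> ereal" where
  "gof_power n \<phi> H1 = (INF p\<in>H1. ereal (reject_prob n \<phi> p))"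

definition asymptotic_level ::
  "(nat \<Rightarrow> (nat \<Rightarrow> 'a::euclidean_space) \<Rightarrow> bool) \<Rightarrow> ('a \<Rightarrow> real) \<Rightarrow> real \<Rightarrow> bool" where
  "asymptotic_level \<Phi> p0 \<alpha> \<longleftrightarrow> limsup (\<lambda>n. ereal (reject_prob n (\<Phi> n) p0)) \<le> ereal \<alpha>"

end

theory Submission
  imports Defs
begin

text \<open>
The hypothesis on the separations provides infinitely many sample sizes \<open>n\<close> at which \<open>\<Delta> n\<close> is at
most a fixed multiple of \<open>n powr (- 2 * s / (d + 4 * s))\<close>, where \<open>d\<close> is the dimension. At each such
large \<open>n\<close> some density in the alternative is hard to tell from \<open>p0\<close>, although it depends on the
test which one it is. This is Ingster's argument with random signs.

An almost everywhere continuous density is bounded below by some \<open>c > 0\<close> on a ball. In that ball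
one places \<open>m ^ d\<close> disjoint rescaled copies \<open>u k\<close>, of width \<open>h = \<rho> / m\<close> and height \<open>\<delta> \<le> c\<close>, of a
fixed compactly supported function \<open>\<phi>\<close> with mean zero, and the candidates are the densities
\<open>p0 + g\<close> with \<open>g = (\<Sum>k. \<plusminus> u k)\<close>, one for each choice of signs. Disjointness of the supports gives all
the \<open>g\<close> the same \<open>L\<^sub>2\<close> norm. Averaged over the signs, the following two bounds hold.

\<^item> The squared Sobolev norm of \<open>g\<close> has expectation \<open>\<Sum>k. \<parallel>u k\<parallel>\<^sup>2\<close>, because the cross terms cancel
  at each frequency (\<open>sum_sobolev_energy_rademacher\<close>). On average the copies thus behave as if they
  were orthogonal in the Sobolev space, although for fractional \<open>s\<close> they need not be.

\<^item> The likelihood ratio of the mixture over all signs has second moment at most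
  \<open>exp (m ^ d * (n * \<delta>\<^sup>2 * h ^ d * \<parallel>\<phi>\<parallel>\<^sup>2 / c)\<^sup>2 / 2)\<close> under \<open>p0\<close>, so that the average rejection probability is
  controlled by the level (\<open>sum_mixture_measure_le\<close>).

One and the same choice of signs then meets both bounds up to a factor 2. With
\<open>q = n powr (2 / (d + 4 * s))\<close>, \<open>m\<close> proportional to \<open>q\<close> and \<open>\<delta>\<close> proportional to \<open>q powr (- s)\<close>, the \<open>L\<^sub>2\<close> distance
reaches \<open>\<Delta> n\<close>, the Sobolev norm of \<open>g\<close> stays within the gap left between \<open>p0\<close> and \<open>M\<close>, and the second
moment remains below a constant \<open>E\<close> (\<open>separation_rate_calibration\<close>). That constant may be large, as
the separation is bounded by an arbitrary multiple of the rate; this is why the level \<open>\<alpha>\<close> has to be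
taken small, of order \<open>1 / E\<close>, to push the power down to \<open>1 / 2\<close>.

The function \<open>\<phi>\<close> is the difference of two translates, with disjoint supports, of a smooth bump, which
is obtained from a tent function by repeated averaging along segments in the
coordinate directions. Each averaging multiplies the Fourier transform by a factor that decays like
the inverse of the frequency, and it preserves continuity and compactness of the support.
\<close>

section \<open>Random signs\<close>

text \<open>Sign vectors indexed by \<open>K\<close> are encoded as subsets of \<open>K\<close>, so that the uniform average over all
signs is a sum over \<open>Pow K\<close> and can be computed by induction on \<open>K\<close>.\<close>

definition rademacher :: "'k set \<Rightarrow> 'k \<Rightarrow> real" where
  "rademacher A k = (if k \<in> A then 1 else - 1)"

lemma rademacher_sq [simp]: "rademacher A k * rademacher A k = 1" "(rademacher A k)\<^sup>2 = 1" "\<bar>rademacher A k\<bar> = 1"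
  by (auto simp: rademacher_def)

lemma sum_Pow_insert:
  fixes f :: "'k set \<Rightarrow> 'b::comm_monoid_add"
  assumes "finite K" "k \<notin> K"
  shows "sum f (Pow (insert k K)) = (\<Sum>A\<in>Pow K. f A + f (insert k A))"
proof -
  have inj: "inj_on (insert k) (Pow K)"
    using assms(2) by (auto simp: inj_on_def)
  have "Pow K \<inter> insert k ` Pow K = {}"
    using assms(2) by auto
  then have "sum f (Pow (insert k K)) = sum f (Pow K) + sum f (insert k ` Pow K)"
    unfolding Pow_insert using assms(1) by (intro sum.union_disjoint) auto
  also have "sum f (insert k ` Pow K) = (\<Sum>A\<in>Pow K. f (insert k A))"
    using inj by (simp add: sum.reindex)
  finally show ?thesis by (simp add: sum.distrib)
qed

lemma rademacher_insert:
  assumes "k \<notin> K" "A \<subseteq> K"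
  shows "rademacher A k = - 1" "rademacher (insert k A) k = 1"
    and "j \<in> K \<Longrightarrow> rademacher (insert k A) j = rademacher A j"
  using assms by (auto simp: rademacher_def)

text \<open>The cross terms cancel on average. In the induction, the two signs of a new index combine by the
parallelogram law.\<close>

lemma sum_cmod_square_rademacher:
  fixes z :: "'k \<Rightarrow> complex"
  assumes "finite K"
  shows "(\<Sum>A\<in>Pow K. (cmod (\<Sum>k\<in>K. of_real (rademacher A k) * z k))\<^sup>2)
       = 2 ^ card K * (\<Sum>k\<in>K. (cmod (z k))\<^sup>2)"
  using assms
proof (induction K)
  case (insert k K)
  define Y where "Y A = (\<Sum>j\<in>K. of_real (rademacher A j) * z j)" for A
  have *: "(\<Sum>j\<in>insert k K. of_real (rademacher A j) * z j) = Y A - z k"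
    "(\<Sum>j\<in>insert k K. of_real (rademacher (insert k A) j) * z j) = Y A + z k" if "A \<in> Pow K" for A
  proof -
    show "(\<Sum>j\<in>insert k K. of_real (rademacher A j) * z j) = Y A - z k"
      using insert that by (simp add: rademacher_insert Y_def)
    have "(\<Sum>j\<in>K. of_real (rademacher (insert k A) j) * z j) = Y A"
      unfolding Y_def using insert.hyps that by (intro sum.cong) (auto simp: rademacher_insert)
    then show "(\<Sum>j\<in>insert k K. of_real (rademacher (insert k A) j) * z j) = Y A + z k"
      using insert that by (simp add: rademacher_insert)
  qed
  have par: "(cmod (a - b))\<^sup>2 + (cmod (a + b))\<^sup>2 = 2 * (cmod a)\<^sup>2 + 2 * (cmod b)\<^sup>2" for a b
    unfolding cmod_power2 by (simp add: power2_eq_square algebra_simps)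
  have "(\<Sum>A\<in>Pow (insert k K). (cmod (\<Sum>j\<in>insert k K. of_real (rademacher A j) * z j))\<^sup>2)
      = (\<Sum>A\<in>Pow K. (cmod (Y A - z k))\<^sup>2 + (cmod (Y A + z k))\<^sup>2)"
    unfolding sum_Pow_insert[OF insert.hyps] by (intro sum.cong) (simp_all only: *)
  also have "\<dots> = 2 * (\<Sum>A\<in>Pow K. (cmod (Y A))\<^sup>2) + 2 * (2 ^ card K * (cmod (z k))\<^sup>2)"
    using insert.hyps by (simp add: par sum.distrib sum_distrib_left[symmetric] card_Pow)
  also have "\<dots> = 2 ^ card (insert k K) * (\<Sum>j\<in>insert k K. (cmod (z j))\<^sup>2)"
      using insert unfolding Y_def by (simp add: distrib_left)
  finally show ?case .
qed simp

lemma cosh_le_exp_half_square: "exp t + exp (- t) \<le> 2 * exp (t\<^sup>2 / 2)" for t :: real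
proof -
  have *: "exp t + exp (- t) \<le> 2 * exp (t\<^sup>2 / 2)" if "t \<ge> 0" for t :: real
  proof -
    have pos: "0 < (1 + exp (2 * t)) / 2"
      by (intro divide_pos_pos add_pos_pos) auto
    \<comment> \<open>Hoeffding's bound for a fair coin with values 0 and \<open>2 * t\<close>, centred\<close>
    have "- (2 * t) * (1 / 2) + ln (1 + 1 / 2 * (exp (2 * t) - 1)) \<le> (2 * t)\<^sup>2 / 8"
      using that by (intro Hoeffdings_lemma_aux) auto
    also have "1 + 1 / 2 * (exp (2 * t) - 1) = (1 + exp (2 * t)) / 2"
      by (simp add: field_simps)
    finally have "ln ((1 + exp (2 * t)) / 2) \<le> t\<^sup>2 / 2 + t"
      by (simp add: power_mult_distrib)
    then have "exp (ln ((1 + exp (2 * t)) / 2)) \<le> exp (t\<^sup>2 / 2 + t)"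
      by simp
    then have "(1 + exp (2 * t)) \<le> 2 * exp (t\<^sup>2 / 2) * exp t"
      using pos by (simp add: exp_add)
    then have "(1 + exp (2 * t)) * exp (- t) \<le> 2 * exp (t\<^sup>2 / 2) * exp t * exp (- t)"
      by (rule mult_right_mono) simp
    then show ?thesis
      by (simp add: distrib_right mult.assoc mult_exp_exp)
  qed
  show ?thesis
    using *[of t] *[of "- t"] by (cases "t \<ge> 0") auto
qed

text \<open>Independence of the signs, in the form that the two signs of a new index contribute the factor
\<open>exp t + exp (- t)\<close>, which is sub-Gaussian.\<close>

lemma sum_exp_rademacher_le:
  fixes t :: "'k \<Rightarrow> real"
  assumes "finite K"
  shows "(\<Sum>A\<in>Pow K. exp (\<Sum>k\<in>K. rademacher A k * t k)) \<le> 2 ^ card K * exp ((\<Sum>k\<in>K. (t k)\<^sup>2) / 2)"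
  using assms
proof (induction K)
  case (insert k K)
  define Y where "Y A = (\<Sum>j\<in>K. rademacher A j * t j)" for A
  have *: "(\<Sum>j\<in>insert k K. rademacher A j * t j) = Y A - t k"
    "(\<Sum>j\<in>insert k K. rademacher (insert k A) j * t j) = Y A + t k" if "A \<in> Pow K" for A
  proof -
    show "(\<Sum>j\<in>insert k K. rademacher A j * t j) = Y A - t k"
      using insert that by (simp add: rademacher_insert Y_def)
    have "(\<Sum>j\<in>K. rademacher (insert k A) j * t j) = Y A"
      unfolding Y_def using insert.hyps that by (intro sum.cong) (auto simp: rademacher_insert)
    then show "(\<Sum>j\<in>insert k K. rademacher (insert k A) j * t j) = Y A + t k"
      using insert that by (simp add: rademacher_insert)
  qed
  have "(\<Sum>A\<in>Pow (insert k K). exp (\<Sum>j\<in>insert k K. rademacher A j * t j))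
      = (\<Sum>A\<in>Pow K. exp (Y A - t k) + exp (Y A + t k))"
    unfolding sum_Pow_insert[OF insert.hyps] by (intro sum.cong) (simp_all only: *)
  also have "\<dots> = (\<Sum>A\<in>Pow K. exp (Y A)) * (exp (t k) + exp (- t k))"
    by (simp add: sum_distrib_right sum.distrib distrib_left exp_diff exp_add exp_minus divide_inverse)
  also have "\<dots> \<le> (2 ^ card K * exp ((\<Sum>j\<in>K. (t j)\<^sup>2) / 2)) * (2 * exp ((t k)\<^sup>2 / 2))"
    using insert.IH by (intro mult_mono cosh_le_exp_half_square) (auto simp: Y_def)
  also have "\<dots> = 2 ^ card (insert k K) * exp ((\<Sum>j\<in>insert k K. (t j)\<^sup>2) / 2)"
    using insert.hyps by (simp add: add_divide_distrib exp_add)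
  finally show ?case .
qed simp

text \<open>When the \<open>y k\<close> are the values at one point of functions with disjoint supports, at most one of them
is nonzero.\<close>

lemma one_plus_sum_rademacher_disjoint_nonneg:
  fixes y :: "'k \<Rightarrow> real"
  assumes "finite K" "\<And>k. k \<in> K \<Longrightarrow> \<bar>y k\<bar> \<le> 1"
    and disj: "\<And>k l. k \<in> K \<Longrightarrow> l \<in> K \<Longrightarrow> k \<noteq> l \<Longrightarrow> y k * y l = 0"
  shows "0 \<le> 1 + (\<Sum>k\<in>K. rademacher A k * y k)"
proof (cases "\<exists>k\<in>K. y k \<noteq> 0")
  case True
  then obtain k where k: "k \<in> K" "y k \<noteq> 0" by auto
  have "(\<Sum>l\<in>K - {k}. rademacher A l * y l) = 0"
    using disj[of k] k by (intro sum.neutral) auto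
  then have "(\<Sum>l\<in>K. rademacher A l * y l) = rademacher A k * y k"
    using assms(1) k by (simp add: sum.remove)
  moreover have "\<bar>rademacher A k * y k\<bar> \<le> 1"
    using assms(2)[OF k(1)] by (simp add: abs_mult)
  ultimately show ?thesis by linarith
qed simp

lemma sum_rademacher_mult_disjoint:
  fixes y :: "'k \<Rightarrow> real"
  assumes "finite K"
    and disj: "\<And>k l. k \<in> K \<Longrightarrow> l \<in> K \<Longrightarrow> k \<noteq> l \<Longrightarrow> y k * y l = 0"
  shows "(\<Sum>k\<in>K. rademacher A k * y k) * (\<Sum>k\<in>K. rademacher B k * y k)
       = (\<Sum>k\<in>K. rademacher A k * rademacher B k * (y k)\<^sup>2)"
proof -
  have "(\<Sum>k\<in>K. rademacher A k * y k) * (\<Sum>k\<in>K. rademacher B k * y k)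
      = (\<Sum>k\<in>K. \<Sum>l\<in>K. rademacher A k * y k * (rademacher B l * y l))"
    by (rule sum_product)
  also have "\<dots> = (\<Sum>k\<in>K. \<Sum>l\<in>K. if l = k then rademacher A k * rademacher B k * (y k)\<^sup>2 else 0)"
    using disj by (intro sum.cong) (auto simp: power2_eq_square)
  also have "\<dots> = (\<Sum>k\<in>K. rademacher A k * rademacher B k * (y k)\<^sup>2)"
    using assms(1) by simp
  finally show ?thesis .
qed

section \<open>Second moment bound for mixtures of product measures\<close>

text \<open>Likelihood ratios of independent observations multiply: both measures have the same value on boxes,
by the product formula for integrals over a product measure.\<close>

lemma PiM_density:
  fixes w :: "'a \<Rightarrow> ennreal"
  assumes "finite I" "prob_space M" "w \<in> borel_measurable M" "prob_space (density M w)"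
  shows "(\<Pi>\<^sub>M i\<in>I. density M w) = density (\<Pi>\<^sub>M i\<in>I. M) (\<lambda>x. \<Prod>i\<in>I. w (x i))"
proof -
  interpret M: prob_space M by fact
  interpret D: prob_space "density M w" by fact
  interpret PM: product_sigma_finite "\<lambda>_. M" by standard
  interpret PD: product_sigma_finite "\<lambda>_. density M w" by standard
  note [measurable] = assms(3)
  have "density (\<Pi>\<^sub>M i\<in>I. M) (\<lambda>x. \<Prod>i\<in>I. w (x i)) = (\<Pi>\<^sub>M i\<in>I. density M w)"
  proof (rule PD.PiM_eqI)
    show "finite I" by fact
    show "sets (density (\<Pi>\<^sub>M i\<in>I. M) (\<lambda>x. \<Prod>i\<in>I. w (x i))) = sets (\<Pi>\<^sub>M i\<in>I. density M w)"
      by (simp cong: sets_PiM_cong)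
    fix S assume S: "\<And>i. i \<in> I \<Longrightarrow> S i \<in> sets (density M w)"
    then have S' [measurable]: "\<And>i. i \<in> I \<Longrightarrow> S i \<in> sets M" by simp
    have PS: "Pi\<^sub>E I S \<in> sets (\<Pi>\<^sub>M i\<in>I. M)"
      using assms(1) S' by (intro sets_PiM_I_finite) auto
    have "emeasure (density (\<Pi>\<^sub>M i\<in>I. M) (\<lambda>x. \<Prod>i\<in>I. w (x i))) (Pi\<^sub>E I S)
        = (\<integral>\<^sup>+ x. (\<Prod>i\<in>I. w (x i)) * indicator (Pi\<^sub>E I S) x \<partial>(\<Pi>\<^sub>M i\<in>I. M))"
      using PS assms(1) by (intro emeasure_density) auto
    also have "\<dots> = (\<integral>\<^sup>+ x. (\<Prod>i\<in>I. w (x i) * indicator (S i) (x i)) \<partial>(\<Pi>\<^sub>M i\<in>I. M))"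
    proof (intro nn_integral_cong)
      fix x assume "x \<in> space (\<Pi>\<^sub>M i\<in>I. M)"
      then have x: "x \<in> extensional I" by (auto simp: space_PiM PiE_def)
      show "(\<Prod>i\<in>I. w (x i)) * indicator (Pi\<^sub>E I S) x = (\<Prod>i\<in>I. w (x i) * indicator (S i) (x i))"
      proof (cases "x \<in> Pi\<^sub>E I S")
        case True
        then show ?thesis by (auto intro!: prod.cong simp: indicator_def)
      next
        case False
        then obtain i where "i \<in> I" "x i \<notin> S i" using x by (auto simp: PiE_def)
        then have "(\<Prod>i\<in>I. w (x i) * indicator (S i) (x i)) = 0"
          using assms(1) by (intro prod_zero) (auto intro!: bexI[of _ i])
        then show ?thesis using False by simp
      qed
    qed
    also have "\<dots> = (\<Prod>i\<in>I. \<integral>\<^sup>+ x. w x * indicator (S i) x \<partial>M)"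
      using assms(1) by (intro PM.product_nn_integral_prod) auto
    also have "\<dots> = (\<Prod>i\<in>I. emeasure (density M w) (S i))"
      using S' by (intro prod.cong refl) (simp add: emeasure_density)
    finally show "emeasure (density (\<Pi>\<^sub>M i\<in>I. M) (\<lambda>x. \<Prod>i\<in>I. w (x i))) (Pi\<^sub>E I S)
        = (\<Prod>i\<in>I. emeasure (density M w) (S i))" .
  qed
  then show ?thesis ..
qed

text \<open>The functions \<open>w A\<close> are the likelihood ratios of the perturbed densities with respect to the null
distribution of one observation. In the product of two of them the linear terms integrate to zero
and, by disjointness, only the diagonal of the quadratic term survives.\<close>

lemma (in prob_space) expectation_rademacher_products:
  fixes v :: "'k \<Rightarrow> 'a \<Rightarrow> real"
  assumes K: "finite K" and [measurable]: "\<And>k. k \<in> K \<Longrightarrow> v k \<in> borel_measurable M"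
    and bd: "\<And>k x. k \<in> K \<Longrightarrow> \<bar>v k x\<bar> \<le> 1"
    and disj: "\<And>k l x. k \<in> K \<Longrightarrow> l \<in> K \<Longrightarrow> k \<noteq> l \<Longrightarrow> v k x * v l x = 0"
    and mean: "\<And>k. k \<in> K \<Longrightarrow> expectation (v k) = 0"
  defines "w \<equiv> (\<lambda>A x. 1 + (\<Sum>k\<in>K. rademacher A k * v k x))"
  shows "(\<integral>\<^sup>+ x. ennreal (w A x) \<partial>M) = 1"
    and "(\<integral>\<^sup>+ x. ennreal (w A x * w B x) \<partial>M)
       = ennreal (1 + (\<Sum>k\<in>K. rademacher A k * rademacher B k * expectation (\<lambda>x. (v k x)\<^sup>2)))"
proof -
  have int: "integrable M (v k)" "integrable M (\<lambda>x. (v k x)\<^sup>2)" if "k \<in> K" for k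
    using that bd[OF that] by (auto intro!: integrable_const_bound[where B = 1] simp: abs_square_le_1)
  have nonneg: "0 \<le> w A x" for A x
    unfolding w_def using K bd disj by (intro one_plus_sum_rademacher_disjoint_nonneg) auto
  have w1: "has_bochner_integral M (w A) (1 + (\<Sum>k\<in>K. rademacher A k * 0))"
    unfolding w_def
    by (intro has_bochner_integral_add has_bochner_integral_sum has_bochner_integral_mult_right)
       (auto simp: has_bochner_integral_iff int mean prob_space)
  then have "(\<integral>\<^sup>+ x. ennreal (w A x) \<partial>M) = ennreal (expectation (w A))"
    using nonneg by (intro nn_integral_eq_integral) (auto simp: has_bochner_integral_iff)
  then show "(\<integral>\<^sup>+ x. ennreal (w A x) \<partial>M) = 1"
    using w1 by (simp add: has_bochner_integral_iff)
  have eq: "w A x * w B x = 1 + (\<Sum>k\<in>K. rademacher A k * v k x) + (\<Sum>k\<in>K. rademacher B k * v k x)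
      + (\<Sum>k\<in>K. rademacher A k * rademacher B k * (v k x)\<^sup>2)" for x
  proof -
    have "(\<Sum>k\<in>K. rademacher A k * v k x) * (\<Sum>k\<in>K. rademacher B k * v k x)
       = (\<Sum>k\<in>K. rademacher A k * rademacher B k * (v k x)\<^sup>2)"
      using K disj by (intro sum_rademacher_mult_disjoint) auto
    then show ?thesis unfolding w_def by (simp add: algebra_simps)
  qed
  have w2: "has_bochner_integral M (\<lambda>x. w A x * w B x)
      (1 + (\<Sum>k\<in>K. rademacher A k * 0) + (\<Sum>k\<in>K. rademacher B k * 0)
         + (\<Sum>k\<in>K. rademacher A k * rademacher B k * expectation (\<lambda>x. (v k x)\<^sup>2)))"
    unfolding eq
    by (intro has_bochner_integral_add has_bochner_integral_sum has_bochner_integral_mult_right)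
       (auto simp: has_bochner_integral_iff int mean prob_space)
  then have "(\<integral>\<^sup>+ x. ennreal (w A x * w B x) \<partial>M) = ennreal (expectation (\<lambda>x. w A x * w B x))"
    using nonneg by (intro nn_integral_eq_integral) (auto simp: has_bochner_integral_iff)
  then show "(\<integral>\<^sup>+ x. ennreal (w A x * w B x) \<partial>M)
       = ennreal (1 + (\<Sum>k\<in>K. rademacher A k * rademacher B k * expectation (\<lambda>x. (v k x)\<^sup>2)))"
    using w2 by (simp add: has_bochner_integral_iff)
qed

text \<open>The second moment under the null of the likelihood ratio of the mixture over all signs, without the
normalising factor \<open>2 ^ card K\<close>. After expanding the square and integrating, each pair of sign
vectors \<open>A\<close>, \<open>B\<close> contributes \<open>(1 + u) ^ n \<le> exp (n * u)\<close> with \<open>u\<close> linear in the signs of \<open>B\<close>, so that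
\<open>sum_exp_rademacher_le\<close> applies for each fixed \<open>A\<close>.\<close>

lemma (in prob_space) sum_likelihood_square_le:
  fixes v :: "'k \<Rightarrow> 'a \<Rightarrow> real"
  assumes K: "finite K" and meas [measurable]: "\<And>k. k \<in> K \<Longrightarrow> v k \<in> borel_measurable M"
    and bd: "\<And>k x. k \<in> K \<Longrightarrow> \<bar>v k x\<bar> \<le> 1"
    and disj: "\<And>k l x. k \<in> K \<Longrightarrow> l \<in> K \<Longrightarrow> k \<noteq> l \<Longrightarrow> v k x * v l x = 0"
    and mean: "\<And>k. k \<in> K \<Longrightarrow> expectation (v k) = 0"
    and var: "\<And>k. k \<in> K \<Longrightarrow> expectation (\<lambda>x. (v k x)\<^sup>2) \<le> a"
  defines "w \<equiv> (\<lambda>A x. 1 + (\<Sum>k\<in>K. rademacher A k * v k x))"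
  shows "(\<integral>\<^sup>+ x. ennreal ((\<Sum>A\<in>Pow K. \<Prod>i<n. w A (x i))\<^sup>2) \<partial>(\<Pi>\<^sub>M i\<in>{..<n}. M))
     \<le> ennreal ((2 ^ card K)\<^sup>2 * exp (real (card K) * (real n * a)\<^sup>2 / 2))"
proof -
  interpret PM: product_sigma_finite "\<lambda>_::nat. M" by standard
  define \<sigma> where "\<sigma> k = expectation (\<lambda>x. (v k x)\<^sup>2)" for k
  have \<sigma>0: "0 \<le> \<sigma> k" for k unfolding \<sigma>_def by simp
  have nonneg: "0 \<le> w A x" for A x
    unfolding w_def using K bd disj by (intro one_plus_sum_rademacher_disjoint_nonneg) auto
  have [measurable]: "w A \<in> borel_measurable M" for A unfolding w_def by measurable
  have prod_le: "(\<integral>\<^sup>+ x. ennreal ((\<Prod>i<n. w A (x i)) * (\<Prod>i<n. w B (x i))) \<partial>(\<Pi>\<^sub>M i\<in>{..<n}. M))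
      \<le> ennreal (exp (\<Sum>k\<in>K. rademacher B k * (real n * rademacher A k * \<sigma> k)))" for A B
  proof -
    define u where "u = (\<Sum>k\<in>K. rademacher A k * rademacher B k * \<sigma> k)"
    have eq: "(\<integral>\<^sup>+ x. ennreal (w A x * w B x) \<partial>M) = ennreal (1 + u)"
      unfolding w_def u_def \<sigma>_def using assms by (intro expectation_rademacher_products(2)) auto
    have "(\<integral>\<^sup>+ x. ennreal ((\<Prod>i<n. w A (x i)) * (\<Prod>i<n. w B (x i))) \<partial>(\<Pi>\<^sub>M i\<in>{..<n}. M))
        = (\<integral>\<^sup>+ x. (\<Prod>i<n. ennreal (w A (x i) * w B (x i))) \<partial>(\<Pi>\<^sub>M i\<in>{..<n}. M))"
      using nonneg by (intro nn_integral_cong) (simp add: prod_ennreal prod.distrib)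
    also have "\<dots> = (\<Prod>i<n. \<integral>\<^sup>+ x. ennreal (w A x * w B x) \<partial>M)"
      by (intro PM.product_nn_integral_prod) auto
    also have "\<dots> = ennreal (1 + u) ^ n" by (simp add: eq)
    also have "\<dots> \<le> ennreal (exp u) ^ n"
      by (intro power_mono ennreal_leI exp_ge_add_one_self) auto
    also have "\<dots> = ennreal (exp (real n * u))"
      by (simp add: ennreal_power exp_of_nat_mult)
    also have "real n * u = (\<Sum>k\<in>K. rademacher B k * (real n * rademacher A k * \<sigma> k))"
      unfolding u_def sum_distrib_left by (intro sum.cong) auto
    finally show ?thesis .
  qed
  have "(\<integral>\<^sup>+ x. ennreal ((\<Sum>A\<in>Pow K. \<Prod>i<n. w A (x i))\<^sup>2) \<partial>(\<Pi>\<^sub>M i\<in>{..<n}. M))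
      = (\<integral>\<^sup>+ x. (\<Sum>A\<in>Pow K. \<Sum>B\<in>Pow K. ennreal ((\<Prod>i<n. w A (x i)) * (\<Prod>i<n. w B (x i))))
          \<partial>(\<Pi>\<^sub>M i\<in>{..<n}. M))"
    using nonneg
    by (intro nn_integral_cong) (simp add: power2_eq_square sum_product sum_ennreal sum_nonneg prod_nonneg)
  also have "\<dots> = (\<Sum>A\<in>Pow K. \<Sum>B\<in>Pow K. \<integral>\<^sup>+ x. ennreal ((\<Prod>i<n. w A (x i)) * (\<Prod>i<n. w B (x i)))
          \<partial>(\<Pi>\<^sub>M i\<in>{..<n}. M))"
    by (subst nn_integral_sum, measurable, subst nn_integral_sum, measurable)
  also have "\<dots> \<le> (\<Sum>A\<in>Pow K. \<Sum>B\<in>Pow K. ennreal (exp (\<Sum>k\<in>K. rademacher B k * (real n * rademacher A k * \<sigma> k))))"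
    by (intro sum_mono prod_le)
  also have "\<dots> = ennreal (\<Sum>A\<in>Pow K. \<Sum>B\<in>Pow K. exp (\<Sum>k\<in>K. rademacher B k * (real n * rademacher A k * \<sigma> k)))"
    by (simp add: sum_ennreal sum_nonneg)
  also have "\<dots> \<le> ennreal (\<Sum>A\<in>Pow K. 2 ^ card K * exp (real (card K) * (real n * a)\<^sup>2 / 2))"
  proof (intro ennreal_leI sum_mono)
    fix A
    have "(\<Sum>B\<in>Pow K. exp (\<Sum>k\<in>K. rademacher B k * (real n * rademacher A k * \<sigma> k)))
        \<le> 2 ^ card K * exp ((\<Sum>k\<in>K. (real n * rademacher A k * \<sigma> k)\<^sup>2) / 2)"
      by (intro sum_exp_rademacher_le K)
    also have "(\<Sum>k\<in>K. (real n * rademacher A k * \<sigma> k)\<^sup>2) \<le> (\<Sum>k\<in>K. (real n * a)\<^sup>2)"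
    proof (intro sum_mono)
      fix k assume "k \<in> K"
      then have "(real n * \<sigma> k)\<^sup>2 \<le> (real n * a)\<^sup>2"
        using var \<sigma>0 by (intro power_mono mult_left_mono) (auto simp: \<sigma>_def)
      then show "(real n * rademacher A k * \<sigma> k)\<^sup>2 \<le> (real n * a)\<^sup>2"
        by (simp add: power_mult_distrib)
    qed
    finally show "(\<Sum>B\<in>Pow K. exp (\<Sum>k\<in>K. rademacher B k * (real n * rademacher A k * \<sigma> k)))
        \<le> 2 ^ card K * exp (real (card K) * (real n * a)\<^sup>2 / 2)"
      by simp
  qed
  also have "(\<Sum>A\<in>Pow K. 2 ^ card K * exp (real (card K) * (real n * a)\<^sup>2 / 2))
      = (2 ^ card K)\<^sup>2 * exp (real (card K) * (real n * a)\<^sup>2 / 2)"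
    using K by (simp add: card_Pow power2_eq_square)
  finally show ?thesis .
qed

text \<open>The sum of the probabilities is the integral of \<open>T * indicator R\<close> under the null, where \<open>T\<close> is the
sum of all likelihood ratios. It is bounded by the null probability of \<open>R\<close> and the second moment of \<open>T\<close>; the
weight \<open>\<theta>\<close> in the arithmetic-geometric mean inequality is free to balance the two.\<close>

lemma (in prob_space) sum_mixture_measure_le:
  fixes v :: "'k \<Rightarrow> 'a \<Rightarrow> real"
  assumes K: "finite K" and meas [measurable]: "\<And>k. k \<in> K \<Longrightarrow> v k \<in> borel_measurable M"
    and bd: "\<And>k x. k \<in> K \<Longrightarrow> \<bar>v k x\<bar> \<le> 1"
    and disj: "\<And>k l x. k \<in> K \<Longrightarrow> l \<in> K \<Longrightarrow> k \<noteq> l \<Longrightarrow> v k x * v l x = 0"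
    and mean: "\<And>k. k \<in> K \<Longrightarrow> expectation (v k) = 0"
    and var: "\<And>k. k \<in> K \<Longrightarrow> expectation (\<lambda>x. (v k x)\<^sup>2) \<le> a"
    and R [measurable]: "R \<in> sets (\<Pi>\<^sub>M i\<in>{..<n}. M)" and \<theta>: "\<theta> > 0"
  defines "w \<equiv> (\<lambda>A x. 1 + (\<Sum>k\<in>K. rademacher A k * v k x))"
  shows "(\<Sum>A\<in>Pow K. measure (\<Pi>\<^sub>M i\<in>{..<n}. density M (\<lambda>x. ennreal (w A x))) R)
     \<le> 2 ^ card K * (\<theta> / 2 * measure (\<Pi>\<^sub>M i\<in>{..<n}. M) R
           + exp (real (card K) * (real n * a)\<^sup>2 / 2) / (2 * \<theta>))"
proof -
  interpret P: prob_space "\<Pi>\<^sub>M i\<in>{..<n}. M" by (intro prob_space_PiM) unfold_locales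
  define P where "P = (\<Pi>\<^sub>M i\<in>{..<n}. M)"
  define N :: real where "N = 2 ^ card K"
  define E where "E = exp (real (card K) * (real n * a)\<^sup>2 / 2)"
  define L where "L A x = (\<Prod>i<n. w A (x i))" for A and x :: "nat \<Rightarrow> 'a"
  define T where "T x = (\<Sum>A\<in>Pow K. L A x)" for x
  have N: "0 < N" unfolding N_def by simp
  have nonneg: "0 \<le> w A x" for A x
    unfolding w_def using K bd disj by (intro one_plus_sum_rademacher_disjoint_nonneg) auto
  then have L0: "0 \<le> L A x" for A x unfolding L_def by (intro prod_nonneg) auto
  have w_meas [measurable]: "w A \<in> borel_measurable M" for A unfolding w_def by measurable
  have L_meas [measurable]: "L A \<in> borel_measurable P" for A unfolding L_def P_def by measurable
  have [measurable]: "R \<in> sets P" unfolding P_def by fact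
  have [measurable]: "T \<in> borel_measurable P" unfolding T_def by measurable
  have em: "emeasure (\<Pi>\<^sub>M i\<in>{..<n}. density M (\<lambda>x. ennreal (w A x))) R
      = (\<integral>\<^sup>+ x. ennreal (L A x * indicator R x) \<partial>P)" for A
  proof -
    have "(\<integral>\<^sup>+ x. ennreal (w A x) \<partial>M) = 1"
      unfolding w_def using assms by (intro expectation_rademacher_products(1)) auto
    then have "prob_space (density M (\<lambda>x. ennreal (w A x)))"
      by (intro prob_spaceI) (simp add: emeasure_density cong: nn_integral_cong)
    then have "(\<Pi>\<^sub>M i\<in>{..<n}. density M (\<lambda>x. ennreal (w A x)))
        = density P (\<lambda>x. \<Prod>i<n. ennreal (w A (x i)))"
      unfolding P_def by (intro PiM_density) (auto intro: prob_space_axioms)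
    also have "\<dots> = density P (\<lambda>x. ennreal (L A x))"
      using nonneg by (simp add: prod_ennreal L_def)
    finally have "emeasure (\<Pi>\<^sub>M i\<in>{..<n}. density M (\<lambda>x. ennreal (w A x))) R
        = (\<integral>\<^sup>+ x. ennreal (L A x) * indicator R x \<partial>P)"
      by (simp add: emeasure_density)
    also have "\<dots> = (\<integral>\<^sup>+ x. ennreal (L A x * indicator R x) \<partial>P)"
      using L0 by (intro nn_integral_cong) (auto simp: indicator_def)
    finally show ?thesis .
  qed
  have T2: "(\<integral>\<^sup>+ x. ennreal ((T x)\<^sup>2) \<partial>P) \<le> ennreal (N\<^sup>2 * E)"
    unfolding T_def L_def P_def N_def E_def w_def
    using K meas bd disj mean var by (rule sum_likelihood_square_le)
  have "(\<Sum>A\<in>Pow K. emeasure (\<Pi>\<^sub>M i\<in>{..<n}. density M (\<lambda>x. ennreal (w A x))) R)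
      = (\<integral>\<^sup>+ x. (\<Sum>A\<in>Pow K. ennreal (L A x * indicator R x)) \<partial>P)"
    unfolding em by (intro nn_integral_sum[symmetric]) measurable
  also have "\<dots> = (\<integral>\<^sup>+ x. ennreal (T x * indicator R x) \<partial>P)"
    using L0 by (intro nn_integral_cong) (simp add: T_def sum_ennreal sum_distrib_right)
  also have "\<dots> \<le> (\<integral>\<^sup>+ x. ennreal (N * \<theta> / 2) * indicator R x + ennreal (1 / (2 * \<theta> * N)) * ennreal ((T x)\<^sup>2) \<partial>P)"
  proof (intro nn_integral_mono)
    fix x
    \<comment> \<open>arithmetic-geometric mean inequality, with \<open>T\<close> of the order of \<open>N\<close> on average\<close>
    have "T x \<le> N * \<theta> / 2 + (T x)\<^sup>2 / (2 * \<theta> * N)"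
    proof -
      have "0 \<le> (T x - N * \<theta>)\<^sup>2 / (2 * \<theta> * N)"
        using N \<theta> by simp
      also have "\<dots> = N * \<theta> / 2 + (T x)\<^sup>2 / (2 * \<theta> * N) - T x"
        using N \<theta> by (simp add: field_simps power2_eq_square)
      finally show ?thesis by simp
    qed
    then have "T x * indicator R x \<le> N * \<theta> / 2 * indicator R x + 1 / (2 * \<theta> * N) * (T x)\<^sup>2"
      using N \<theta> by (auto simp: indicator_def)
    then have "ennreal (T x * indicator R x) \<le> ennreal (N * \<theta> / 2 * indicator R x + 1 / (2 * \<theta> * N) * (T x)\<^sup>2)"
      by (rule ennreal_leI)
    also have "\<dots> = ennreal (N * \<theta> / 2) * indicator R x + ennreal (1 / (2 * \<theta> * N)) * ennreal ((T x)\<^sup>2)"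
      using N \<theta> by (subst ennreal_plus) (auto simp: ennreal_mult[symmetric] indicator_def)
    finally show "ennreal (T x * indicator R x)
        \<le> ennreal (N * \<theta> / 2) * indicator R x + ennreal (1 / (2 * \<theta> * N)) * ennreal ((T x)\<^sup>2)" .
  qed
  also have "\<dots> = ennreal (N * \<theta> / 2) * emeasure P R
      + ennreal (1 / (2 * \<theta> * N)) * (\<integral>\<^sup>+ x. ennreal ((T x)\<^sup>2) \<partial>P)"
    by (simp add: nn_integral_add nn_integral_cmult nn_integral_cmult_indicator)
  also have "\<dots> \<le> ennreal (N * \<theta> / 2) * emeasure P R + ennreal (1 / (2 * \<theta> * N)) * ennreal (N\<^sup>2 * E)"
    by (intro add_left_mono mult_left_mono T2) simp
  also have "ennreal (N * \<theta> / 2) * emeasure P R + ennreal (1 / (2 * \<theta> * N)) * ennreal (N\<^sup>2 * E)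
     = ennreal (N * (\<theta> / 2 * measure P R + E / (2 * \<theta>)))"
    using N \<theta> unfolding P_def E_def
    by (simp add: P.emeasure_eq_measure ennreal_mult[symmetric] field_simps power2_eq_square
          flip: ennreal_plus)
  finally have le: "(\<Sum>A\<in>Pow K. emeasure (\<Pi>\<^sub>M i\<in>{..<n}. density M (\<lambda>x. ennreal (w A x))) R)
     \<le> ennreal (N * (\<theta> / 2 * measure P R + E / (2 * \<theta>)))"
    .
  have fin: "emeasure (\<Pi>\<^sub>M i\<in>{..<n}. density M (\<lambda>x. ennreal (w A x))) R \<noteq> \<infinity>" if "A \<in> Pow K" for A
  proof -
    have "emeasure (\<Pi>\<^sub>M i\<in>{..<n}. density M (\<lambda>x. ennreal (w A x))) R
        \<le> (\<Sum>A\<in>Pow K. emeasure (\<Pi>\<^sub>M i\<in>{..<n}. density M (\<lambda>x. ennreal (w A x))) R)"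
      using that K by (intro member_le_sum) auto
    also note le
    also have "ennreal (N * (\<theta> / 2 * measure P R + E / (2 * \<theta>))) < \<infinity>" by simp
    finally show ?thesis by simp
  qed
  have "ennreal (\<Sum>A\<in>Pow K. measure (\<Pi>\<^sub>M i\<in>{..<n}. density M (\<lambda>x. ennreal (w A x))) R)
     = (\<Sum>A\<in>Pow K. emeasure (\<Pi>\<^sub>M i\<in>{..<n}. density M (\<lambda>x. ennreal (w A x))) R)"
    using fin by (subst sum_ennreal[symmetric]) (auto intro!: sum.cong simp: emeasure_eq_ennreal_measure)
  also note le
  finally have "(\<Sum>A\<in>Pow K. measure (\<Pi>\<^sub>M i\<in>{..<n}. density M (\<lambda>x. ennreal (w A x))) R)
      \<le> N * (\<theta> / 2 * measure P R + E / (2 * \<theta>))"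
    using \<theta> N by (subst (asm) ennreal_le_iff) (auto simp: E_def)
  then show ?thesis by (simp only: P_def N_def E_def)
qed

section \<open>Fourier transform and Sobolev energy\<close>

lemma integrable_fourier_kernel:
  fixes f :: "'a::euclidean_space \<Rightarrow> real"
  assumes "integrable lborel f"
  shows "integrable lborel (\<lambda>x. complex_of_real (f x) * exp (- (\<i> * complex_of_real (x \<bullet> \<omega>))))"
proof (rule Bochner_Integration.integrable_bound[OF assms])
  have [measurable]: "f \<in> borel_measurable lborel" using assms by auto
  show "(\<lambda>x. complex_of_real (f x) * exp (- (\<i> * complex_of_real (x \<bullet> \<omega>)))) \<in> borel_measurable lborel"
    by measurable
qed (simp add: norm_mult)

lemma fourier_add:
  assumes "integrable lborel f" "integrable lborel g"
  shows "fourier (\<lambda>x. f x + g x) \<omega> = fourier f \<omega> + fourier g \<omega>"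
  using assms[THEN integrable_fourier_kernel, of \<omega>]
  unfolding fourier_def by (simp add: algebra_simps)

lemma fourier_cmult: "fourier (\<lambda>x. a * f x) \<omega> = of_real a * fourier f \<omega>"
  unfolding fourier_def by (simp add: mult.assoc mult.left_commute)

lemma fourier_sum:
  assumes "\<And>k. k \<in> K \<Longrightarrow> integrable lborel (f k)"
  shows "fourier (\<lambda>x. \<Sum>k\<in>K. f k x) \<omega> = (\<Sum>k\<in>K. fourier (f k) \<omega>)"
proof -
  have "(LINT x|lborel. complex_of_real (\<Sum>k\<in>K. f k x) * exp (- (\<i> * complex_of_real (x \<bullet> \<omega>))))
      = (\<Sum>k\<in>K. LINT x|lborel. complex_of_real (f k x) * exp (- (\<i> * complex_of_real (x \<bullet> \<omega>))))"
    unfolding of_real_sum sum_distrib_right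
    by (intro Bochner_Integration.integral_sum integrable_fourier_kernel assms)
  then show ?thesis unfolding fourier_def by (simp add: sum_distrib_left)
qed

lemma fourier_measurable [measurable]:
  fixes f :: "'a::euclidean_space \<Rightarrow> real"
  assumes [measurable]: "f \<in> borel_measurable borel"
  shows "fourier f \<in> borel_measurable borel"
  unfolding fourier_def by measurable

text \<open>The square of \<open>sobolev_enorm\<close>, which unlike the norm itself is additive on average over signs.\<close>

definition sobolev_energy :: "real \<Rightarrow> ('a::euclidean_space \<Rightarrow> real) \<Rightarrow> ennreal" where
  "sobolev_energy s f =
     (\<integral>\<^sup>+ \<omega>. ennreal ((1 + (norm \<omega>)\<^sup>2) powr s * (cmod (fourier f \<omega>))\<^sup>2) \<partial>lborel)"

lemma integral_lborel_affine:
  fixes f :: "'a::euclidean_space \<Rightarrow> 'b::{banach, second_countable_topology}"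
  assumes [measurable]: "f \<in> borel_measurable borel" and h: "h > 0"
  shows "(LINT x|lborel. f x) = h ^ DIM('a) *\<^sub>R (LINT x|lborel. f (a + h *\<^sub>R x))"
proof -
  have "(LINT x|lborel. f x)
      = (LINT x|density (distr lborel borel (\<lambda>x. a + h *\<^sub>R x)) (\<lambda>_. ennreal (\<bar>h\<bar> ^ DIM('a))). f x)"
    using h by (subst lborel_affine[of h a]) auto
  also have "\<dots> = h ^ DIM('a) *\<^sub>R (LINT x|lborel. f (a + h *\<^sub>R x))"
    using h by (simp add: integral_density integral_distr)
  finally show ?thesis .
qed

lemma integrable_lborel_affine:
  fixes f :: "'a::euclidean_space \<Rightarrow> 'b::{banach, second_countable_topology}"
  assumes f: "integrable lborel f" and h: "h > 0"
  shows "integrable lborel (\<lambda>x. f (a + h *\<^sub>R x))"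
proof -
  have [measurable]: "f \<in> borel_measurable borel" using f by auto
  have "integrable (density (distr lborel borel (\<lambda>x. a + h *\<^sub>R x)) (\<lambda>_. ennreal (\<bar>h\<bar> ^ DIM('a)))) f"
    using f h by (subst (asm) lborel_affine[of h a]) auto
  then have "integrable lborel (\<lambda>x. h ^ DIM('a) *\<^sub>R f (a + h *\<^sub>R x))"
    using h by (simp add: integrable_density integrable_distr_eq)
  then have "integrable lborel (\<lambda>x. inverse (h ^ DIM('a)) *\<^sub>R (h ^ DIM('a) *\<^sub>R f (a + h *\<^sub>R x)))"
    by (rule integrable_scaleR_right)
  then show ?thesis using h by simp
qed

lemma nn_integral_lborel_affine:
  fixes f :: "'a::euclidean_space \<Rightarrow> ennreal"
  assumes [measurable]: "f \<in> borel_measurable borel" and h: "h > 0"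
  shows "(\<integral>\<^sup>+ x. f x \<partial>lborel) = ennreal (h ^ DIM('a)) * (\<integral>\<^sup>+ x. f (a + h *\<^sub>R x) \<partial>lborel)"
proof -
  have "(\<integral>\<^sup>+ x. f x \<partial>lborel)
      = (\<integral>\<^sup>+ x. f x \<partial>density (distr lborel borel (\<lambda>x. a + h *\<^sub>R x)) (\<lambda>_. ennreal (\<bar>h\<bar> ^ DIM('a))))"
    using h by (subst lborel_affine[of h a]) auto
  also have "\<dots> = ennreal (h ^ DIM('a)) * (\<integral>\<^sup>+ x. f (a + h *\<^sub>R x) \<partial>lborel)"
    using h by (simp add: nn_integral_density nn_integral_distr nn_integral_cmult)
  finally show ?thesis .
qed

text \<open>Translations only change the phase of the Fourier transform, and the dilation by \<open>h\<close> concentrates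
the mass on frequencies of order \<open>1 / h\<close>.\<close>

lemma fourier_dilate:
  fixes f :: "'a::euclidean_space \<Rightarrow> real"
  assumes [measurable]: "f \<in> borel_measurable borel" and h: "h > 0"
  shows "fourier (\<lambda>x. f ((x - a) /\<^sub>R h)) \<omega>
       = of_real (h ^ DIM('a)) * exp (- (\<i> * complex_of_real (a \<bullet> \<omega>))) * fourier f (h *\<^sub>R \<omega>)"
proof -
  have "(LINT x|lborel. complex_of_real (f ((x - a) /\<^sub>R h)) * exp (- (\<i> * complex_of_real (x \<bullet> \<omega>))))
     = h ^ DIM('a) *\<^sub>R (LINT x|lborel. complex_of_real (f ((a + h *\<^sub>R x - a) /\<^sub>R h)) * exp (- (\<i> * complex_of_real ((a + h *\<^sub>R x) \<bullet> \<omega>))))"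
    using h by (intro integral_lborel_affine) auto
  also have "\<dots> = h ^ DIM('a) *\<^sub>R (LINT x|lborel. exp (- (\<i> * complex_of_real (a \<bullet> \<omega>)))
       * (complex_of_real (f x) * exp (- (\<i> * complex_of_real (x \<bullet> (h *\<^sub>R \<omega>))))))"
  proof (intro arg_cong[where f = "\<lambda>z. h ^ DIM('a) *\<^sub>R z"] Bochner_Integration.integral_cong refl)
    fix x :: 'a
    have "(a + h *\<^sub>R x - a) /\<^sub>R h = x" using h by simp
    moreover have "exp (- (\<i> * complex_of_real ((a + h *\<^sub>R x) \<bullet> \<omega>)))
        = exp (- (\<i> * complex_of_real (a \<bullet> \<omega>))) * exp (- (\<i> * complex_of_real (x \<bullet> (h *\<^sub>R \<omega>))))"
      by (simp add: mult_exp_exp inner_add_left distrib_left)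
    ultimately show "complex_of_real (f ((a + h *\<^sub>R x - a) /\<^sub>R h)) * exp (- (\<i> * complex_of_real ((a + h *\<^sub>R x) \<bullet> \<omega>)))
      = exp (- (\<i> * complex_of_real (a \<bullet> \<omega>))) * (complex_of_real (f x) * exp (- (\<i> * complex_of_real (x \<bullet> (h *\<^sub>R \<omega>)))))"
      by simp
  qed
  finally have "(LINT x|lborel. complex_of_real (f ((x - a) /\<^sub>R h)) * exp (- (\<i> * complex_of_real (x \<bullet> \<omega>))))
     = of_real (h ^ DIM('a)) * (exp (- (\<i> * complex_of_real (a \<bullet> \<omega>)))
        * (LINT x|lborel. complex_of_real (f x) * exp (- (\<i> * complex_of_real (x \<bullet> (h *\<^sub>R \<omega>))))))"
    unfolding integral_mult_right_zero scaleR_conv_of_real .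
  then show ?thesis
    unfolding fourier_def by (simp only: mult_ac)
qed

lemma fourier_zero: "fourier f 0 = of_real ((2 * pi) powr (- real DIM('a) / 2) * (LINT x|lborel. f x))"
  for f :: "'a::euclidean_space \<Rightarrow> real"
  unfolding fourier_def by (simp add: integral_complex_of_real)

lemma esqrt_less_infinity_iff: "esqrt x < \<infinity> \<longleftrightarrow> x < \<infinity>"
  by (auto simp: esqrt_def less_top)

lemma esqrt_ennreal: "0 \<le> r \<Longrightarrow> esqrt (ennreal r) = ennreal (sqrt r)"
  by (simp add: esqrt_def)

lemma esqrt_le_ennreal:
  assumes "x \<le> ennreal (M\<^sup>2)" "0 \<le> M"
  shows "esqrt x \<le> ennreal M"
proof -
  obtain r where r: "x = ennreal r" "0 \<le> r" using assms(1) by (cases x) (auto simp: top_unique)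
  then have "r \<le> M\<^sup>2" using assms by (simp add: ennreal_le_iff)
  then have "sqrt r \<le> M" using assms(2) by (simp add: real_le_lsqrt)
  then show ?thesis using r by (simp add: esqrt_ennreal ennreal_leI)
qed

lemma sobolev_enorm_eq: "sobolev_enorm s f = esqrt (sobolev_energy s f)"
  by (simp add: sobolev_enorm_def sobolev_energy_def)

text \<open>In the integral for the dilated function, substitute \<open>h *\<^sub>R \<omega>\<close> for the frequency; for \<open>h \<le> 1\<close> the weight
\<open>1 + (norm \<omega>)\<^sup>2\<close> is at most \<open>h powr (- 2)\<close> times the weight at \<open>h *\<^sub>R \<omega>\<close>.\<close>

lemma sobolev_energy_dilate_le:
  fixes \<phi> :: "'a::euclidean_space \<Rightarrow> real"
  assumes [measurable]: "\<phi> \<in> borel_measurable borel" and h: "0 < h" "h \<le> 1" and s: "s > 0"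
  shows "sobolev_energy s (\<lambda>x. \<phi> ((x - a) /\<^sub>R h))
       \<le> ennreal (h ^ DIM('a) * h powr (- 2 * s)) * sobolev_energy s \<phi>"
proof -
  let ?k = "\<lambda>\<omega>::'a. (1 + (norm \<omega>)\<^sup>2) powr s * (cmod (fourier \<phi> \<omega>))\<^sup>2"
  let ?D = "h ^ DIM('a)"
  have pt: "(1 + (norm \<omega>)\<^sup>2) powr s * (cmod (fourier (\<lambda>x. \<phi> ((x - a) /\<^sub>R h)) \<omega>))\<^sup>2
      \<le> ?D * h powr (- 2 * s) * (?D * ?k (h *\<^sub>R \<omega>))" for \<omega>
  proof -
    have "h\<^sup>2 \<le> 1" using h by (simp add: power_le_one)
    then have "1 + (norm \<omega>)\<^sup>2 \<le> h powr (- 2) * (1 + (norm (h *\<^sub>R \<omega>))\<^sup>2)"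
      using h by (simp add: powr_minus powr_numeral power_mult_distrib field_simps)
    then have "(1 + (norm \<omega>)\<^sup>2) powr s \<le> (h powr (- 2) * (1 + (norm (h *\<^sub>R \<omega>))\<^sup>2)) powr s"
      using s by (intro powr_mono2) auto
    also have "\<dots> = h powr (- 2 * s) * (1 + (norm (h *\<^sub>R \<omega>))\<^sup>2) powr s"
      using h by (simp add: powr_mult powr_powr add_nonneg_nonneg)
    finally have "(1 + (norm \<omega>)\<^sup>2) powr s \<le> h powr (- 2 * s) * (1 + (norm (h *\<^sub>R \<omega>))\<^sup>2) powr s" .
    moreover have "(cmod (fourier (\<lambda>x. \<phi> ((x - a) /\<^sub>R h)) \<omega>))\<^sup>2 = ?D * ?D * (cmod (fourier \<phi> (h *\<^sub>R \<omega>)))\<^sup>2"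
      using h by (subst fourier_dilate) (auto simp: norm_mult power_mult_distrib power2_eq_square norm_power)
    ultimately have "(1 + (norm \<omega>)\<^sup>2) powr s * (cmod (fourier (\<lambda>x. \<phi> ((x - a) /\<^sub>R h)) \<omega>))\<^sup>2
      \<le> (h powr (- 2 * s) * (1 + (norm (h *\<^sub>R \<omega>))\<^sup>2) powr s) * (?D * ?D * (cmod (fourier \<phi> (h *\<^sub>R \<omega>)))\<^sup>2)"
      by (simp only:) (intro mult_right_mono, auto)
    then show ?thesis by (simp only: mult_ac)
  qed
  have "sobolev_energy s (\<lambda>x. \<phi> ((x - a) /\<^sub>R h))
      \<le> (\<integral>\<^sup>+ \<omega>. ennreal (?D * h powr (- 2 * s)) * (ennreal ?D * ennreal (?k (0 + h *\<^sub>R \<omega>))) \<partial>lborel)"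
    unfolding sobolev_energy_def
  proof (intro nn_integral_mono)
    fix \<omega> :: 'a
    have "ennreal ((1 + (norm \<omega>)\<^sup>2) powr s * (cmod (fourier (\<lambda>x. \<phi> ((x - a) /\<^sub>R h)) \<omega>))\<^sup>2)
      \<le> ennreal (?D * h powr (- 2 * s) * (?D * ?k (h *\<^sub>R \<omega>)))"
      by (intro ennreal_leI pt)
    then show "ennreal ((1 + (norm \<omega>)\<^sup>2) powr s * (cmod (fourier (\<lambda>x. \<phi> ((x - a) /\<^sub>R h)) \<omega>))\<^sup>2)
      \<le> ennreal (?D * h powr (- 2 * s)) * (ennreal ?D * ennreal (?k (0 + h *\<^sub>R \<omega>)))"
      using h by (simp add: ennreal_mult')
  qed
  also have "\<dots> = ennreal (?D * h powr (- 2 * s)) * (ennreal ?D * (\<integral>\<^sup>+ \<omega>. ennreal (?k (0 + h *\<^sub>R \<omega>)) \<partial>lborel))"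
    by (subst nn_integral_cmult, measurable, subst nn_integral_cmult, measurable)
  also have "ennreal ?D * (\<integral>\<^sup>+ \<omega>. ennreal (?k (0 + h *\<^sub>R \<omega>)) \<partial>lborel) = sobolev_energy s \<phi>"
    unfolding sobolev_energy_def using h by (intro nn_integral_lborel_affine[symmetric]) auto
  finally show ?thesis .
qed

lemma sobolev_energy_cmult: 
  assumes [measurable]: "f \<in> borel_measurable borel"
  shows "sobolev_energy s (\<lambda>x. a * f x) = ennreal (a\<^sup>2) * sobolev_energy s f"
proof -
  have "(1 + (norm \<omega>)\<^sup>2) powr s * (cmod (fourier (\<lambda>x. a * f x) \<omega>))\<^sup>2
      = a\<^sup>2 * ((1 + (norm \<omega>)\<^sup>2) powr s * (cmod (fourier f \<omega>))\<^sup>2)" for \<omega>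
    by (simp add: fourier_cmult norm_mult power_mult_distrib)
  then have "sobolev_energy s (\<lambda>x. a * f x)
      = (\<integral>\<^sup>+ \<omega>. ennreal (a\<^sup>2) * ennreal ((1 + (norm \<omega>)\<^sup>2) powr s * (cmod (fourier f \<omega>))\<^sup>2) \<partial>lborel)"
    unfolding sobolev_energy_def by (simp only:) (intro nn_integral_cong ennreal_mult, auto)
  then show ?thesis
    unfolding sobolev_energy_def by (subst (asm) nn_integral_cmult) auto
qed

text \<open>A triangle inequality for squared norms. The free parameter \<open>\<theta>\<close> leaves the factor of the energy of \<open>f\<close>
as close to 1 as desired, at the expense of the energy of \<open>g\<close>.\<close>

lemma sobolev_energy_add_le:
  fixes f g :: "'a::euclidean_space \<Rightarrow> real"
  assumes f: "integrable lborel f" and g: "integrable lborel g" and \<theta>: "\<theta> > 0"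
  shows "sobolev_energy s (\<lambda>x. f x + g x)
       \<le> ennreal (1 + \<theta>) * sobolev_energy s f + ennreal (1 + 1 / \<theta>) * sobolev_energy s g"
proof -
  have [measurable]: "f \<in> borel_measurable borel" "g \<in> borel_measurable borel"
    using f g by auto
  let ?w = "\<lambda>\<omega>::'a. (1 + (norm \<omega>)\<^sup>2) powr s"
  have pt: "?w \<omega> * (cmod (fourier (\<lambda>x. f x + g x) \<omega>))\<^sup>2
      \<le> (1 + \<theta>) * (?w \<omega> * (cmod (fourier f \<omega>))\<^sup>2) + (1 + 1 / \<theta>) * (?w \<omega> * (cmod (fourier g \<omega>))\<^sup>2)" for \<omega>
  proof -
    define a where "a = cmod (fourier f \<omega>)"
    define b where "b = cmod (fourier g \<omega>)"
    have "(cmod (fourier (\<lambda>x. f x + g x) \<omega>))\<^sup>2 \<le> (a + b)\<^sup>2"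
      unfolding a_def b_def fourier_add[OF f g] by (intro power_mono norm_triangle_ineq) auto
    also have "\<dots> \<le> (1 + \<theta>) * a\<^sup>2 + (1 + 1 / \<theta>) * b\<^sup>2"
    proof -
      have "0 \<le> (\<theta> * a - b)\<^sup>2 / \<theta>" using \<theta> by simp
      also have "\<dots> = (1 + \<theta>) * a\<^sup>2 + (1 + 1 / \<theta>) * b\<^sup>2 - (a + b)\<^sup>2"
        using \<theta> by (simp add: field_simps power2_eq_square)
      finally show ?thesis by simp
    qed
    finally have "?w \<omega> * (cmod (fourier (\<lambda>x. f x + g x) \<omega>))\<^sup>2 \<le> ?w \<omega> * ((1 + \<theta>) * a\<^sup>2 + (1 + 1 / \<theta>) * b\<^sup>2)"
      by (intro mult_left_mono) auto
    then show ?thesis unfolding a_def b_def by (simp add: algebra_simps)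
  qed
  have "sobolev_energy s (\<lambda>x. f x + g x)
      \<le> (\<integral>\<^sup>+ \<omega>. ennreal (1 + \<theta>) * ennreal (?w \<omega> * (cmod (fourier f \<omega>))\<^sup>2)
            + ennreal (1 + 1 / \<theta>) * ennreal (?w \<omega> * (cmod (fourier g \<omega>))\<^sup>2) \<partial>lborel)"
    unfolding sobolev_energy_def
  proof (intro nn_integral_mono)
    fix \<omega> :: 'a
    have "ennreal (?w \<omega> * (cmod (fourier (\<lambda>x. f x + g x) \<omega>))\<^sup>2)
      \<le> ennreal ((1 + \<theta>) * (?w \<omega> * (cmod (fourier f \<omega>))\<^sup>2) + (1 + 1 / \<theta>) * (?w \<omega> * (cmod (fourier g \<omega>))\<^sup>2))"
      by (intro ennreal_leI pt)
    also have "\<dots> = ennreal ((1 + \<theta>) * (?w \<omega> * (cmod (fourier f \<omega>))\<^sup>2))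
        + ennreal ((1 + 1 / \<theta>) * (?w \<omega> * (cmod (fourier g \<omega>))\<^sup>2))"
      using \<theta> by (intro ennreal_plus) auto
    also have "\<dots> = ennreal (1 + \<theta>) * ennreal (?w \<omega> * (cmod (fourier f \<omega>))\<^sup>2)
            + ennreal (1 + 1 / \<theta>) * ennreal (?w \<omega> * (cmod (fourier g \<omega>))\<^sup>2)"
      using \<theta> by (intro arg_cong2[where f = "(+)"] ennreal_mult) auto
    finally show "ennreal (?w \<omega> * (cmod (fourier (\<lambda>x. f x + g x) \<omega>))\<^sup>2)
      \<le> ennreal (1 + \<theta>) * ennreal (?w \<omega> * (cmod (fourier f \<omega>))\<^sup>2)
            + ennreal (1 + 1 / \<theta>) * ennreal (?w \<omega> * (cmod (fourier g \<omega>))\<^sup>2)" .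
  qed
  also have "\<dots> = ennreal (1 + \<theta>) * sobolev_energy s f + ennreal (1 + 1 / \<theta>) * sobolev_energy s g"
    unfolding sobolev_energy_def
    by (subst nn_integral_add) (auto simp: nn_integral_cmult)
  finally show ?thesis .
qed

text \<open>The identity \<open>sum_cmod_square_rademacher\<close> applied at each frequency and then integrated.\<close>

lemma sum_sobolev_energy_rademacher:
  fixes u :: "'k \<Rightarrow> 'a::euclidean_space \<Rightarrow> real"
  assumes K: "finite K" and u: "\<And>k. k \<in> K \<Longrightarrow> integrable lborel (u k)"
  shows "(\<Sum>A\<in>Pow K. sobolev_energy s (\<lambda>x. \<Sum>k\<in>K. rademacher A k * u k x))
       = ennreal (2 ^ card K) * (\<Sum>k\<in>K. sobolev_energy s (u k))"
proof -
  have [measurable]: "u k \<in> borel_measurable borel" if "k \<in> K" for k using u[OF that] by auto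
  have [measurable]: "fourier (u k) \<in> borel_measurable borel" if "k \<in> K" for k
    using that by measurable
  have F: "fourier (\<lambda>x. \<Sum>k\<in>K. rademacher A k * u k x) \<omega> = (\<Sum>k\<in>K. of_real (rademacher A k) * fourier (u k) \<omega>)" for A \<omega>
    using u by (subst fourier_sum) (auto simp: fourier_cmult)
  let ?w = "\<lambda>\<omega>::'a. (1 + (norm \<omega>)\<^sup>2) powr s"
  have "(\<Sum>A\<in>Pow K. sobolev_energy s (\<lambda>x. \<Sum>k\<in>K. rademacher A k * u k x))
      = (\<integral>\<^sup>+ \<omega>. (\<Sum>A\<in>Pow K. ennreal (?w \<omega> * (cmod (\<Sum>k\<in>K. of_real (rademacher A k) * fourier (u k) \<omega>))\<^sup>2)) \<partial>lborel)"
    unfolding sobolev_energy_def F by (intro nn_integral_sum[symmetric]) measurable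
  also have "\<dots> = (\<integral>\<^sup>+ \<omega>. ennreal (2 ^ card K) * (\<Sum>k\<in>K. ennreal (?w \<omega> * (cmod (fourier (u k) \<omega>))\<^sup>2)) \<partial>lborel)"
  proof (intro nn_integral_cong)
    fix \<omega> :: 'a
    have "(\<Sum>A\<in>Pow K. ennreal (?w \<omega> * (cmod (\<Sum>k\<in>K. of_real (rademacher A k) * fourier (u k) \<omega>))\<^sup>2))
        = ennreal (?w \<omega> * (\<Sum>A\<in>Pow K. (cmod (\<Sum>k\<in>K. of_real (rademacher A k) * fourier (u k) \<omega>))\<^sup>2))"
      by (simp add: sum_distrib_left)
    also have "\<dots> = ennreal (2 ^ card K * (\<Sum>k\<in>K. ?w \<omega> * (cmod (fourier (u k) \<omega>))\<^sup>2))"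
      unfolding sum_cmod_square_rademacher[OF K] by (simp add: sum_distrib_left mult_ac)
    also have "\<dots> = ennreal (2 ^ card K) * (\<Sum>k\<in>K. ennreal (?w \<omega> * (cmod (fourier (u k) \<omega>))\<^sup>2))"
      by (subst ennreal_mult) (auto simp: sum_nonneg)
    finally show "(\<Sum>A\<in>Pow K. ennreal (?w \<omega> * (cmod (\<Sum>k\<in>K. of_real (rademacher A k) * fourier (u k) \<omega>))\<^sup>2))
        = ennreal (2 ^ card K) * (\<Sum>k\<in>K. ennreal (?w \<omega> * (cmod (fourier (u k) \<omega>))\<^sup>2))" .
  qed
  also have "\<dots> = ennreal (2 ^ card K) * (\<Sum>k\<in>K. sobolev_energy s (u k))"
    unfolding sobolev_energy_def
    by (subst nn_integral_cmult, measurable, subst nn_integral_sum, measurable)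
  finally show ?thesis .
qed

section \<open>A compactly supported wavelet of finite Sobolev energy\<close>

text \<open>The Fourier transform of the uniform distribution on the unit interval, up to normalisation.\<close>

definition interval_ft :: "real \<Rightarrow> complex" where
  "interval_ft y = (LINT t|lborel. indicator {0..1::real} t *\<^sub>R exp (- (\<i> * complex_of_real (t * y))))"

lemma interval_ft_zero: "interval_ft 0 = 1"
  by (simp add: interval_ft_def)

text \<open>For small frequencies the trivial bound 1 suffices; for large ones the antiderivative of the
exponential gives \<open>2 / \<bar>y\<bar>\<close>.\<close>

lemma interval_ft_decay: "(cmod (interval_ft y))\<^sup>2 \<le> 8 / (1 + y\<^sup>2)"
proof -
  have le1: "cmod (interval_ft y) \<le> 1"
  proof -
    have "cmod (interval_ft y) \<le> (LINT t|lborel. indicator {0..1::real} t)"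
      unfolding interval_ft_def
      by (rule order_trans[OF integral_norm_bound]) simp
    then show ?thesis by simp
  qed
  show ?thesis
  proof (cases "\<bar>y\<bar> \<le> 1")
    case True
    then have "y\<^sup>2 \<le> 1" by (simp add: abs_square_le_1)
    then have "1 \<le> 8 / (1 + y\<^sup>2)" by (simp add: field_simps add_pos_nonneg)
    moreover have "(cmod (interval_ft y))\<^sup>2 \<le> 1" using le1 by (simp add: power_le_one)
    ultimately show ?thesis by linarith
  next
    case False
    define F where "F t = exp (- (\<i> * complex_of_real (t * y))) / (- (\<i> * of_real y))" for t
    have y: "y \<noteq> 0" using False by auto
    have "has_bochner_integral lborel (\<lambda>t. indicator {0..1} t *\<^sub>R exp (- (\<i> * complex_of_real (t * y)))) (F 1 - F 0)"
    proof (rule has_bochner_integral_FTC_Icc)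
      fix x :: real
      show "(F has_vector_derivative exp (- (\<i> * complex_of_real (x * y)))) (at x within {0..1})"
        unfolding F_def using y
        by (auto intro!: derivative_eq_intros has_vector_derivative_real_field simp: field_simps)
    qed (auto intro!: continuous_intros)
    then have "interval_ft y = F 1 - F 0"
      unfolding interval_ft_def by (simp add: has_bochner_integral_iff)
    moreover have "cmod (F t) = 1 / \<bar>y\<bar>" for t
      by (simp add: F_def norm_divide norm_mult)
    ultimately have "cmod (interval_ft y) \<le> 2 / \<bar>y\<bar>"
      using norm_triangle_ineq4[of "F 1" "F 0"] by simp
    then have "(cmod (interval_ft y))\<^sup>2 \<le> (2 / \<bar>y\<bar>)\<^sup>2"
      by (intro power_mono) auto
    also have "\<dots> = 4 / y\<^sup>2" by (simp add: power_divide)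
    also have "\<dots> \<le> 8 / (1 + y\<^sup>2)"
    proof -
      have "1 \<le> y\<^sup>2" using False by (simp add: abs_square_less_1 flip: not_less)
      then have "4 * (1 + y\<^sup>2) \<le> 8 * y\<^sup>2" by simp
      then show ?thesis using \<open>1 \<le> y\<^sup>2\<close> by (simp add: divide_simps add_pos_nonneg)
    qed
    finally show ?thesis .
  qed
qed

text \<open>The properties that survive averaging along a segment. Continuity takes the form of the
Lipschitz constant 1, which passes to averages pointwise.\<close>

definition bump :: "('a::euclidean_space \<Rightarrow> real) \<Rightarrow> bool" where
  "bump f \<longleftrightarrow> (\<forall>x y. \<bar>f x - f y\<bar> \<le> dist x y) \<and> (\<forall>x. 0 \<le> f x \<and> f x \<le> 1) \<and>
     (\<exists>R. \<forall>x. norm x \<ge> R \<longrightarrow> f x = 0) \<and> 0 < (LINT x|lborel. f x)"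

lemma continuous_if_nonexpansive:
  fixes f :: "'a::euclidean_space \<Rightarrow> real"
  assumes "\<And>x y. \<bar>f x - f y\<bar> \<le> dist x y"
  shows "continuous_on UNIV f"
proof (rule continuous_onI)
  fix x :: 'a and e :: real assume "e > 0"
  have "dist (f y) (f x) \<le> e" if "dist y x < e" for y
    using assms[of y x] that by (simp add: dist_real_def)
  then show "\<exists>d>0. \<forall>x'\<in>UNIV. dist x' x < d \<longrightarrow> dist (f x') (f x) \<le> e"
    using \<open>e > 0\<close> by auto
qed

lemma bump_continuous: "bump f \<Longrightarrow> continuous_on UNIV f"
  by (rule continuous_if_nonexpansive) (simp add: bump_def)

lemma integrable_compact_support:
  fixes f :: "'a::euclidean_space \<Rightarrow> real"
  assumes "f \<in> borel_measurable borel" "\<And>x. \<bar>f x\<bar> \<le> B" "\<And>x. norm x \<ge> R \<Longrightarrow> f x = 0"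
  shows "integrable lborel f"
proof (rule integrableI_bounded_set[where A = "cball 0 R" and B = B])
  show "emeasure lborel (cball 0 R :: 'a set) < \<infinity>"
    by (intro emeasure_bounded_finite bounded_cball)
qed (use assms in auto)

lemma bump_integrable: assumes "bump f" shows "integrable lborel f"
proof -
  obtain R where R: "\<And>x. norm x \<ge> R \<Longrightarrow> f x = 0" using assms by (auto simp: bump_def)
  show ?thesis
  proof (rule integrable_compact_support[where B = 1, OF _ _ R])
    show "f \<in> borel_measurable borel"
      using bump_continuous[OF assms] by (rule borel_measurable_continuous_onI)
  qed (use assms in \<open>auto simp: bump_def\<close>)
qed

text \<open>The convolution with the uniform distribution on the segment from 0 to \<open>v\<close>.\<close>

definition moving_average :: "'a::euclidean_space \<Rightarrow> ('a \<Rightarrow> real) \<Rightarrow> 'a \<Rightarrow> real" where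
  "moving_average v f x = (LINT t|lborel. indicator {0..1::real} t * f (x - t *\<^sub>R v))"

text \<open>By Fubini's theorem, translating by \<open>t *\<^sub>R v\<close> multiplies the Fourier transform by a phase, and the
phases are averaged over \<open>t\<close>.\<close>

lemma fourier_moving_average:
  fixes f :: "'a::euclidean_space \<Rightarrow> real"
  assumes f: "bump f"
  shows "fourier (moving_average v f) \<omega> = fourier f \<omega> * interval_ft (v \<bullet> \<omega>)"
proof -
  have [measurable]: "f \<in> borel_measurable borel"
    using bump_continuous[OF f] by (rule borel_measurable_continuous_onI)
  obtain R where R: "\<And>x. norm x \<ge> R \<Longrightarrow> f x = 0" using f by (auto simp: bump_def)
  have f01: "0 \<le> f x" "f x \<le> 1" for x using f by (auto simp: bump_def)
  define R' where "R' = R + norm v"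
  have supp: "f (x - t *\<^sub>R v) = 0" if "norm x \<ge> R'" "t \<in> {0..1}" for x t
  proof (rule R)
    have "norm (t *\<^sub>R v) \<le> norm v" using that by (simp add: mult_left_le_one_le)
    then show "R \<le> norm (x - t *\<^sub>R v)"
      using norm_triangle_ineq2[of x "t *\<^sub>R v"] that unfolding R'_def by linarith
  qed
  define k where "k x t = indicator {0..1::real} t *\<^sub>R (complex_of_real (f (x - t *\<^sub>R v)) * exp (- (\<i> * complex_of_real (x \<bullet> \<omega>))))" for x t
  have k_meas [measurable]: "case_prod k \<in> borel_measurable (lborel \<Otimes>\<^sub>M lborel)"
    unfolding k_def by measurable
  have k_int: "integrable (lborel \<Otimes>\<^sub>M lborel) (case_prod k)"
  proof (rule integrableI_bounded_set[where A = "cball 0 R' \<times> {0..1}" and B = 1])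
    have "emeasure (lborel \<Otimes>\<^sub>M lborel) (cball (0::'a) R' \<times> {0..1::real}) 
       = emeasure lborel (cball (0::'a) R') * emeasure lborel {0..1::real}"
      by (intro lborel.emeasure_pair_measure_Times) auto
    moreover have "emeasure lborel (cball (0::'a) R') < \<infinity>"
      by (intro emeasure_bounded_finite bounded_cball)
    ultimately show "emeasure (lborel \<Otimes>\<^sub>M lborel) (cball (0::'a) R' \<times> {0..1::real}) < \<infinity>"
      by (simp add: ennreal_mult_less_top)
    show "AE x in lborel \<Otimes>\<^sub>M lborel. x \<in> cball (0::'a) R' \<times> {0..1} \<longrightarrow> norm (case_prod k x) \<le> 1"
      using f01 by (auto simp: k_def norm_mult)
    show "AE z in lborel \<Otimes>\<^sub>M lborel. z \<notin> cball (0::'a) R' \<times> {0..1} \<longrightarrow> case_prod k z = 0"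
    proof (intro AE_I2 impI)
      fix z :: "'a \<times> real" assume "z \<notin> cball 0 R' \<times> {0..1}"
      then show "case_prod k z = 0"
        using supp[of "fst z" "snd z"] by (cases z) (auto simp: k_def indicator_def)
    qed
  qed auto
  have "complex_of_real (moving_average v f x) * exp (- (\<i> * complex_of_real (x \<bullet> \<omega>))) = (LINT t|lborel. k x t)" for x
  proof -
    have "complex_of_real (moving_average v f x)
        = (LINT t|lborel. complex_of_real (indicator {0..1::real} t * f (x - t *\<^sub>R v)))"
      unfolding moving_average_def by (rule integral_complex_of_real[symmetric])
    then have "complex_of_real (moving_average v f x) * exp (- (\<i> * complex_of_real (x \<bullet> \<omega>)))
        = (LINT t|lborel. complex_of_real (indicator {0..1::real} t * f (x - t *\<^sub>R v)) * exp (- (\<i> * complex_of_real (x \<bullet> \<omega>))))"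
      by simp
    then show ?thesis
      by (simp only: k_def scaleR_conv_of_real of_real_mult mult.assoc)
  qed
  then have "(LINT x|lborel. complex_of_real (moving_average v f x) * exp (- (\<i> * complex_of_real (x \<bullet> \<omega>))))
    = (LINT x|lborel. LINT t|lborel. k x t)" by simp
  also have "\<dots> = (LINT t|lborel. LINT x|lborel. k x t)"
    using k_int by (rule lborel_pair.Fubini_integral[symmetric])
  also have "\<dots> = (LINT t|lborel. (indicator {0..1::real} t *\<^sub>R exp (- (\<i> * complex_of_real (t * (v \<bullet> \<omega>)))))
        * (LINT x|lborel. complex_of_real (f x) * exp (- (\<i> * complex_of_real (x \<bullet> \<omega>)))))"
  proof (intro Bochner_Integration.integral_cong refl)
    fix t :: real
    have "(LINT x|lborel. k x t) = (LINT x|lborel. k (t *\<^sub>R v + 1 *\<^sub>R x) t)"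
      by (subst integral_lborel_affine[where h = 1 and a = "t *\<^sub>R v"]) (auto simp: k_def)
    also have "\<dots> = (LINT x|lborel. (indicator {0..1::real} t *\<^sub>R exp (- (\<i> * complex_of_real (t * (v \<bullet> \<omega>)))))
         * (complex_of_real (f x) * exp (- (\<i> * complex_of_real (x \<bullet> \<omega>)))))"
      by (intro Bochner_Integration.integral_cong)
         (auto simp: k_def inner_add_left distrib_left mult_exp_exp)
    finally show "(LINT x|lborel. k x t) = (indicator {0..1::real} t *\<^sub>R exp (- (\<i> * complex_of_real (t * (v \<bullet> \<omega>)))))
        * (LINT x|lborel. complex_of_real (f x) * exp (- (\<i> * complex_of_real (x \<bullet> \<omega>))))"
      by simp
  qed
  also have "\<dots> = interval_ft (v \<bullet> \<omega>) * (LINT x|lborel. complex_of_real (f x) * exp (- (\<i> * complex_of_real (x \<bullet> \<omega>))))"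
    unfolding interval_ft_def by (rule integral_mult_left_zero)
  finally show ?thesis
    unfolding fourier_def by (simp add: mult_ac)
qed

lemma bump_moving_average:
  fixes f :: "'a::euclidean_space \<Rightarrow> real"
  assumes f: "bump f"
  shows "bump (moving_average v f)"
proof -
  have [measurable]: "f \<in> borel_measurable borel"
    using bump_continuous[OF f] by (rule borel_measurable_continuous_onI)
  obtain R where R: "\<And>x. norm x \<ge> R \<Longrightarrow> f x = 0" using f by (auto simp: bump_def)
  have f01: "0 \<le> f x" "f x \<le> 1" for x using f by (auto simp: bump_def)
  define R' where "R' = R + norm v"
  have supp: "f (x - t *\<^sub>R v) = 0" if "norm x \<ge> R'" "t \<in> {0..1}" for x t
  proof (rule R)
    have "norm (t *\<^sub>R v) \<le> norm v" using that by (simp add: mult_left_le_one_le)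
    then show "R \<le> norm (x - t *\<^sub>R v)"
      using norm_triangle_ineq2[of x "t *\<^sub>R v"] that unfolding R'_def by linarith
  qed
  have int_slice: "integrable lborel (\<lambda>t. indicator {0..1::real} t * f (x - t *\<^sub>R v))" for x
    by (rule integrable_compact_support[where B = 1 and R = 2])
       (use f01 in \<open>auto simp: indicator_def\<close>)

  show ?thesis
    unfolding bump_def
  proof (intro conjI allI)
    fix x y
    have "\<bar>moving_average v f x - moving_average v f y\<bar>
       = \<bar>LINT t|lborel. indicator {0..1::real} t * f (x - t *\<^sub>R v) - indicator {0..1::real} t * f (y - t *\<^sub>R v)\<bar>"
      unfolding moving_average_def by (subst Bochner_Integration.integral_diff) (auto intro: int_slice)
    also have "\<dots> \<le> (LINT t|lborel. indicator {0..1::real} t * dist x y)"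
    proof (rule integral_abs_bound_integral)
      show "\<bar>indicator {0..1} t * f (x - t *\<^sub>R v) - indicator {0..1} t * f (y - t *\<^sub>R v)\<bar> \<le> indicator {0..1} t * dist x y" for t :: real
      proof -
        have "\<bar>f (x - t *\<^sub>R v) - f (y - t *\<^sub>R v)\<bar> \<le> dist (x - t *\<^sub>R v) (y - t *\<^sub>R v)"
          using f by (simp add: bump_def)
        then show ?thesis by (auto simp: indicator_def dist_norm)
      qed
    qed (auto intro: int_slice)
    finally show "\<bar>moving_average v f x - moving_average v f y\<bar> \<le> dist x y" by simp
    show "0 \<le> moving_average v f x"
      unfolding moving_average_def using f01 by (intro Bochner_Integration.integral_nonneg) auto
    have "moving_average v f x \<le> (LINT t|lborel. indicator {0..1::real} t)"
      unfolding moving_average_def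
    proof (intro integral_mono int_slice)
      show "indicator {0..1} t * f (x - t *\<^sub>R v) \<le> indicator {0..1} t" for t :: real
        using f01 by (auto simp: indicator_def)
    qed simp
    then show "moving_average v f x \<le> 1" by simp
  next
    have "moving_average v f x = 0" if "R' \<le> norm x" for x
      unfolding moving_average_def
      using supp[OF that] by (intro integral_eq_zero_AE AE_I2) (auto simp: indicator_def)
    then show "\<exists>R. \<forall>x. R \<le> norm x \<longrightarrow> moving_average v f x = 0" by blast
  next
    have "fourier (moving_average v f) 0 = fourier f 0"
      by (simp add: fourier_moving_average[OF f] interval_ft_zero)
    then have "(LINT x|lborel. moving_average v f x) = (LINT x|lborel. f x)"
      unfolding fourier_zero of_real_eq_iff by simp
    then show "0 < (LINT x|lborel. moving_average v f x)"
      using f by (simp add: bump_def)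
  qed
qed

lemma bump_tent: "bump (\<lambda>x::'a::euclidean_space. max 0 (1 - norm x))"
proof -
  let ?f = "\<lambda>x::'a. max 0 (1 - norm x)"
  have lip: "\<bar>?f x - ?f y\<bar> \<le> dist x y" for x y
    using norm_triangle_ineq3[of x y] by (auto simp: dist_norm max_def abs_if split: if_splits)
  have int: "integrable lborel ?f"
    by (rule integrable_compact_support[where B = 1 and R = 1]) auto
  have "(LINT x|lborel. ?f x) \<noteq> 0"
  proof
    assume "(LINT x|lborel. ?f x) = 0"
    then have "AE x in lborel. ?f x = 0"
      using int by (subst (asm) integral_nonneg_eq_0_iff_AE) auto
    then have "AE x in lborel. x \<notin> ball (0::'a) 1"
      by eventually_elim auto
    then have "emeasure lborel (ball (0::'a) 1) = 0"
      by (subst (asm) AE_iff_measurable[where N = "ball (0::'a) 1"]) auto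
    then show False
      using content_ball_pos[of 1 "0::'a"] by (simp add: measure_def)
  qed
  then have "0 < (LINT x|lborel. ?f x)"
    by (simp add: order_less_le integral_nonneg)
  with lip show ?thesis unfolding bump_def by (auto intro!: exI[of _ 1])
qed

text \<open>Iteration of the moving average, \<open>m\<close> times in each of the directions in \<open>B\<close>.\<close>

lemma bump_fourier_product_exists:
  fixes f :: "'a::euclidean_space \<Rightarrow> real"
  assumes "finite B" "bump f"
  shows "\<exists>g. bump g \<and> (\<forall>\<omega>. fourier g \<omega> = fourier f \<omega> * (\<Prod>b\<in>B. interval_ft (b \<bullet> \<omega>) ^ m))"
  using assms(1)
proof (induction B)
  case (insert v B)
  then obtain g where g: "bump g" "\<And>\<omega>. fourier g \<omega> = fourier f \<omega> * (\<Prod>b\<in>B. interval_ft (b \<bullet> \<omega>) ^ m)"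
    by blast
  have "\<exists>g'. bump g' \<and> (\<forall>\<omega>. fourier g' \<omega> = fourier g \<omega> * interval_ft (v \<bullet> \<omega>) ^ j)" for j
  proof (induction j)
    case (Suc j)
    then obtain g' where "bump g'" "\<forall>\<omega>. fourier g' \<omega> = fourier g \<omega> * interval_ft (v \<bullet> \<omega>) ^ j" by blast
    then show ?case
      by (intro exI[of _ "moving_average v g'"]) (simp add: bump_moving_average fourier_moving_average mult_ac)
  qed (use g(1) in auto)
  from this[of m] show ?case
    using insert.hyps by (auto simp: g(2) mult_ac)
qed (use assms(2) in auto)

lemma one_plus_sum_le_prod:
  fixes a :: "'b \<Rightarrow> real"
  assumes "finite B" "\<And>b. b \<in> B \<Longrightarrow> 0 \<le> a b"
  shows "1 + sum a B \<le> (\<Prod>b\<in>B. 1 + a b)"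
  using assms
proof (induction B)
  case (insert v B)
  have "1 + sum a (insert v B) \<le> (1 + a v) * (1 + sum a B)"
    using insert by (simp add: algebra_simps sum_nonneg)
  also have "\<dots> \<le> (1 + a v) * (\<Prod>b\<in>B. 1 + a b)"
    using insert by (intro mult_left_mono) auto
  finally show ?case using insert by simp
qed simp

lemma cmod_fourier_le:
  fixes f :: "'a::euclidean_space \<Rightarrow> real"
  shows "cmod (fourier f \<omega>) \<le> (2 * pi) powr (- real DIM('a) / 2) * (LINT x|lborel. \<bar>f x\<bar>)"
proof -
  have "cmod (LINT x|lborel. complex_of_real (f x) * exp (- (\<i> * complex_of_real (x \<bullet> \<omega>))))
     \<le> (LINT x|lborel. \<bar>f x\<bar>)"
    by (rule order_trans[OF integral_norm_bound]) (simp add: norm_mult)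
  then show ?thesis unfolding fourier_def by (simp add: norm_mult mult_left_mono)
qed

lemma nn_integral_inverse_1_plus_square: "(\<integral>\<^sup>+ y. ennreal (inverse (1 + y\<^sup>2)) \<partial>lborel) < \<infinity>" for y :: real
proof -
  have "einterval (-\<infinity>) \<infinity> = (UNIV :: real set)" by (auto simp: einterval_def)
  then have "integrable lborel (\<lambda>y::real. inverse (1 + y\<^sup>2))"
    using integrable_inverse_1_plus_square by (simp add: set_integrable_def)
  then show ?thesis
    by (subst nn_integral_eq_integral) (auto simp: add_nonneg_nonneg)
qed

text \<open>With the basis vectors as directions and \<open>m \<ge> s + 1\<close>, both the weight and the squared Fourier
transform are bounded by products over the coordinates, so that the integral factorises into
convergent integrals of \<open>1 / (1 + y\<^sup>2)\<close>.\<close>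

lemma smooth_bump_exists:
  fixes s :: real
  assumes "s > 0"
  shows "\<exists>f :: 'a::euclidean_space \<Rightarrow> real. bump f \<and>
    sobolev_energy s f < \<infinity>"
proof -
  let ?t = "\<lambda>x::'a. max 0 (1 - norm x)"
  define m where "m = nat \<lceil>s\<rceil> + 1"
  have m: "s - real m \<le> - 1" unfolding m_def using assms by linarith
  obtain f :: "'a \<Rightarrow> real" where f: "bump f"
    and F: "\<And>\<omega>. fourier f \<omega> = fourier ?t \<omega> * (\<Prod>b\<in>Basis. interval_ft (b \<bullet> \<omega>) ^ m)"
    using bump_fourier_product_exists[OF finite_Basis bump_tent] by blast
  define C where "C = (2 * pi) powr (- real DIM('a) / 2) * (LINT x|lborel. \<bar>?t x\<bar>)"
  have C: "cmod (fourier ?t \<omega>) \<le> C" for \<omega>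
    unfolding C_def by (rule cmod_fourier_le)
  have pt: "(1 + (norm \<omega>)\<^sup>2) powr s * (cmod (fourier f \<omega>))\<^sup>2
      \<le> C\<^sup>2 * (\<Prod>b\<in>Basis. 8 ^ m * inverse (1 + (\<omega> \<bullet> b)\<^sup>2))" for \<omega> :: 'a
  proof -
    have "(norm \<omega>)\<^sup>2 = (\<Sum>b\<in>Basis. (\<omega> \<bullet> b)\<^sup>2)"
      unfolding power2_norm_eq_inner by (subst euclidean_inner) (simp add: power2_eq_square)
    then have "1 + (norm \<omega>)\<^sup>2 \<le> (\<Prod>b\<in>Basis. 1 + (\<omega> \<bullet> b)\<^sup>2)"
      by (simp add: one_plus_sum_le_prod)
    then have "(1 + (norm \<omega>)\<^sup>2) powr s \<le> (\<Prod>b\<in>Basis. 1 + (\<omega> \<bullet> b)\<^sup>2) powr s"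
      using assms by (intro powr_mono2) auto
    also have "\<dots> = (\<Prod>b\<in>Basis. (1 + (\<omega> \<bullet> b)\<^sup>2) powr s)"
      by (rule prod_powr_distrib)
    finally have 1: "(1 + (norm \<omega>)\<^sup>2) powr s \<le> (\<Prod>b\<in>Basis. (1 + (\<omega> \<bullet> b)\<^sup>2) powr s)" .
    have "(cmod (fourier f \<omega>))\<^sup>2 = (cmod (fourier ?t \<omega>))\<^sup>2 * (\<Prod>b\<in>Basis. ((cmod (interval_ft (\<omega> \<bullet> b)))\<^sup>2) ^ m)"
      by (simp add: F norm_mult prod_norm[symmetric] norm_power power_mult_distrib prod_power_distrib
           inner_commute mult.commute flip: power_mult)
    also have "\<dots> \<le> C\<^sup>2 * (\<Prod>b\<in>Basis. (8 / (1 + (\<omega> \<bullet> b)\<^sup>2)) ^ m)"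
      by (intro mult_mono prod_mono power_mono conjI C interval_ft_decay prod_nonneg) auto
    finally have "(1 + (norm \<omega>)\<^sup>2) powr s * (cmod (fourier f \<omega>))\<^sup>2
       \<le> (\<Prod>b\<in>Basis. (1 + (\<omega> \<bullet> b)\<^sup>2) powr s) * (C\<^sup>2 * (\<Prod>b\<in>Basis. (8 / (1 + (\<omega> \<bullet> b)\<^sup>2)) ^ m))"
      using 1 by (intro mult_mono) (auto intro!: prod_nonneg)
    also have "\<dots> = C\<^sup>2 * (\<Prod>b\<in>Basis. (1 + (\<omega> \<bullet> b)\<^sup>2) powr s * (8 / (1 + (\<omega> \<bullet> b)\<^sup>2)) ^ m)"
      by (simp add: prod.distrib)
    also have "\<dots> \<le> C\<^sup>2 * (\<Prod>b\<in>Basis. 8 ^ m * inverse (1 + (\<omega> \<bullet> b)\<^sup>2))"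
    proof (intro mult_left_mono prod_mono conjI)
      fix b
      define z where "z = 1 + (\<omega> \<bullet> b)\<^sup>2"
      have z: "1 \<le> z" unfolding z_def by simp
      have "z powr s * (8 / z) ^ m = 8 ^ m * z powr (s - real m)"
        using z by (simp add: power_divide powr_diff powr_realpow)
      also have "\<dots> \<le> 8 ^ m * z powr (- 1)"
        using z m by (intro mult_left_mono powr_mono) auto
      finally show "z powr s * (8 / z) ^ m \<le> 8 ^ m * inverse z"
        using z by (simp add: powr_minus)
    qed (auto simp: add_nonneg_nonneg)
    finally show ?thesis .
  qed
  have "(\<integral>\<^sup>+ \<omega>. ennreal ((1 + (norm \<omega>)\<^sup>2) powr s * (cmod (fourier f \<omega>))\<^sup>2) \<partial>lborel)
      \<le> (\<integral>\<^sup>+ \<omega>. ennreal (C\<^sup>2) * (\<Prod>b\<in>Basis. ennreal (8 ^ m * inverse (1 + (\<omega> \<bullet> b)\<^sup>2))) \<partial>(lborel :: 'a measure))"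
  proof (intro nn_integral_mono)
    fix \<omega> :: 'a
    have "ennreal ((1 + (norm \<omega>)\<^sup>2) powr s * (cmod (fourier f \<omega>))\<^sup>2)
        \<le> ennreal (C\<^sup>2 * (\<Prod>b\<in>Basis. 8 ^ m * inverse (1 + (\<omega> \<bullet> b)\<^sup>2)))"
      by (intro ennreal_leI pt)
    also have "\<dots> = ennreal (C\<^sup>2) * (\<Prod>b\<in>Basis. ennreal (8 ^ m * inverse (1 + (\<omega> \<bullet> b)\<^sup>2)))"
      by (subst prod_ennreal) (auto simp: ennreal_mult add_nonneg_nonneg intro!: prod_nonneg ennreal_mult)
    finally show "ennreal ((1 + (norm \<omega>)\<^sup>2) powr s * (cmod (fourier f \<omega>))\<^sup>2)
        \<le> ennreal (C\<^sup>2) * (\<Prod>b\<in>Basis. ennreal (8 ^ m * inverse (1 + (\<omega> \<bullet> b)\<^sup>2)))" .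
  qed
  also have "\<dots> = ennreal (C\<^sup>2) * (\<Prod>b\<in>(Basis :: 'a set). \<integral>\<^sup>+ y. ennreal (8 ^ m * inverse (1 + y\<^sup>2)) \<partial>lborel)"
    using nn_integral_lborel_prod[of "\<lambda>_::'a. \<lambda>y. ennreal (8 ^ m * inverse (1 + y\<^sup>2))"]
    by (subst nn_integral_cmult) auto
  also have "\<dots> < \<infinity>"
  proof -
    have "(\<integral>\<^sup>+ y. ennreal (8 ^ m * inverse (1 + y\<^sup>2)) \<partial>lborel) 
        = ennreal (8 ^ m) * (\<integral>\<^sup>+ y. ennreal (inverse (1 + y\<^sup>2)) \<partial>lborel)"
      by (subst nn_integral_cmult[symmetric]) (auto simp: ennreal_mult add_nonneg_nonneg)
    also have "\<dots> < \<infinity>"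
      using nn_integral_inverse_1_plus_square by (simp add: ennreal_mult_less_top)
    finally show ?thesis
      by (simp add: ennreal_mult_less_top power_less_top_ennreal)
  qed
  finally show ?thesis using f unfolding sobolev_energy_def by blast
qed

text \<open>The difference of a bump and a translate of it with disjoint support has mean zero, is not
negligible, and its Fourier transform is at most twice that of the bump in absolute value.\<close>

lemma wavelet_exists:
  fixes s :: real
  assumes "s > 0"
  obtains \<phi> :: "'a::euclidean_space \<Rightarrow> real" and R :: real
  where "R > 0" "continuous_on UNIV \<phi>" "\<And>x. \<bar>\<phi> x\<bar> \<le> 1" "\<And>x. R \<le> norm x \<Longrightarrow> \<phi> x = 0"
    "(LINT x|lborel. \<phi> x) = 0" "0 < (LINT x|lborel. (\<phi> x)\<^sup>2)"
    "sobolev_energy s \<phi> < \<infinity>"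
proof -
  obtain f :: "'a \<Rightarrow> real" where f: "bump f"
    and Ffin: "sobolev_energy s f < \<infinity>"
    using smooth_bump_exists[OF assms] by blast
  obtain R0 where R0: "\<And>x. norm x \<ge> R0 \<Longrightarrow> f x = 0" using f by (auto simp: bump_def)
  define R1 where "R1 = max R0 1"
  have R1: "R1 > 0" "\<And>x. norm x \<ge> R1 \<Longrightarrow> f x = 0" unfolding R1_def using R0 by auto
  have f01: "0 \<le> f x" "f x \<le> 1" for x using f by (auto simp: bump_def)
  note f_cont = bump_continuous[OF f] and f_int = bump_integrable[OF f]
  have f_meas [measurable]: "f \<in> borel_measurable borel"
    using f_cont by (rule borel_measurable_continuous_onI)
  define v :: 'a where "v = (2 * R1) *\<^sub>R (SOME b. b \<in> Basis)"
  have v: "norm v = 2 * R1"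
    unfolding v_def using R1 by (simp add: SOME_Basis)
  \<comment> \<open>the shift is twice the radius of the support of the bump\<close>
  define \<phi> where "\<phi> x = f x - f (x - v)" for x
  have far: "f (x - v) = 0" if "f x \<noteq> 0" for x
  proof (rule R1(2))
    have "norm x < R1" using that R1(2)[of x] by (cases "norm x < R1") auto
    then show "R1 \<le> norm (x - v)"
      using norm_triangle_ineq2[of v x] v by (simp add: norm_minus_commute)
  qed
  have shift_int: "integrable lborel (\<lambda>x. f (x - v))"
    using integrable_lborel_affine[OF f_int, of 1 "- v"] by simp
  have phi_cont: "continuous_on UNIV \<phi>"
    unfolding \<phi>_def
    by (intro continuous_intros f_cont continuous_on_compose2[OF f_cont]) auto
  then have [measurable]: "\<phi> \<in> borel_measurable borel"
    by (rule borel_measurable_continuous_onI)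
  have phi_le: "\<bar>\<phi> x\<bar> \<le> 1" for x
    using f01[of x] f01[of "x - v"] unfolding \<phi>_def by linarith
  have phi_supp: "\<phi> x = 0" if "3 * R1 \<le> norm x" for x
  proof -
    have "R1 \<le> norm x" "R1 \<le> norm (x - v)"
      using that R1(1) v norm_triangle_ineq2[of x v] by auto
    then show ?thesis unfolding \<phi>_def by (simp add: R1(2))
  qed
  have phi_mean: "(LINT x|lborel. \<phi> x) = 0"
    using integral_lborel_affine[of f 1 "- v"] f_int shift_int unfolding \<phi>_def by simp
  have f2_int: "integrable lborel (\<lambda>x. (f x)\<^sup>2)"
    by (rule integrable_compact_support[where B = 1 and R = R1])
       (use f01 R1 in \<open>auto simp: abs_square_le_1\<close>)
  have phi2_int: "integrable lborel (\<lambda>x. (\<phi> x)\<^sup>2)"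
    by (rule integrable_compact_support[where B = 1 and R = "3 * R1"])
       (use phi_le phi_supp in \<open>auto simp: abs_square_le_1\<close>)
  have "(LINT x|lborel. (f x)\<^sup>2) \<noteq> 0"
  proof
    assume "(LINT x|lborel. (f x)\<^sup>2) = 0"
    then have "AE x in lborel. f x = 0"
      using f2_int by (subst (asm) integral_nonneg_eq_0_iff_AE) auto
    then have "(LINT x|lborel. f x) = 0"
      by (rule integral_eq_zero_AE)
    then show False using f by (simp add: bump_def)
  qed
  then have "0 < (LINT x|lborel. (f x)\<^sup>2)"
    by (simp add: order_less_le)
  also have "\<dots> \<le> (LINT x|lborel. (\<phi> x)\<^sup>2)"
  proof (intro integral_mono f2_int phi2_int)
    show "(f x)\<^sup>2 \<le> (\<phi> x)\<^sup>2" for x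
      using far[of x] by (cases "f x = 0") (auto simp: \<phi>_def)
  qed
  finally have phi2_pos: "0 < (LINT x|lborel. (\<phi> x)\<^sup>2)" .
  have F: "(cmod (fourier \<phi> \<omega>))\<^sup>2 \<le> 4 * (cmod (fourier f \<omega>))\<^sup>2" for \<omega>
  proof -
    define e where "e = exp (- (\<i> * complex_of_real (v \<bullet> \<omega>)))"
    have "fourier (\<lambda>x. f (x - v)) \<omega> = e * fourier f \<omega>"
      using fourier_dilate[of f 1 v \<omega>] by (simp add: e_def)
    then have "fourier \<phi> \<omega> = fourier f \<omega> - e * fourier f \<omega>"
      using fourier_add[of f "\<lambda>x. - 1 * f (x - v)" \<omega>] f_int shift_int
        fourier_cmult[of "- 1" "\<lambda>x. f (x - v)" \<omega>]
      by (simp add: \<phi>_def[abs_def])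
    then have "cmod (fourier \<phi> \<omega>) \<le> cmod (fourier f \<omega>) + cmod (e * fourier f \<omega>)"
      by (simp add: norm_triangle_ineq4)
    also have "\<dots> = 2 * cmod (fourier f \<omega>)"
      by (simp add: e_def norm_mult)
    finally have "(cmod (fourier \<phi> \<omega>))\<^sup>2 \<le> (2 * cmod (fourier f \<omega>))\<^sup>2"
      by (intro power_mono) auto
    then show ?thesis by (simp add: power_mult_distrib)
  qed
  have "(\<integral>\<^sup>+ \<omega>. ennreal ((1 + (norm \<omega>)\<^sup>2) powr s * (cmod (fourier \<phi> \<omega>))\<^sup>2) \<partial>lborel)
     \<le> (\<integral>\<^sup>+ \<omega>. ennreal 4 * ennreal ((1 + (norm \<omega>)\<^sup>2) powr s * (cmod (fourier f \<omega>))\<^sup>2) \<partial>lborel)"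
  proof (intro nn_integral_mono)
    fix \<omega> :: 'a
    have "(1 + (norm \<omega>)\<^sup>2) powr s * (cmod (fourier \<phi> \<omega>))\<^sup>2
        \<le> (1 + (norm \<omega>)\<^sup>2) powr s * (4 * (cmod (fourier f \<omega>))\<^sup>2)"
      by (intro mult_left_mono F) auto
    then show "ennreal ((1 + (norm \<omega>)\<^sup>2) powr s * (cmod (fourier \<phi> \<omega>))\<^sup>2)
        \<le> ennreal 4 * ennreal ((1 + (norm \<omega>)\<^sup>2) powr s * (cmod (fourier f \<omega>))\<^sup>2)"
      by (subst ennreal_mult[symmetric]) (auto intro!: ennreal_leI simp: mult_ac)
  qed
  also have "\<dots> < \<infinity>"
    using Ffin unfolding sobolev_energy_def by (subst nn_integral_cmult) (auto simp: ennreal_mult_less_top)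
  finally show thesis
    using that[of "3 * R1" \<phi>] R1(1) phi_cont phi_le phi_supp phi_mean phi2_pos
    unfolding sobolev_energy_def by auto
qed

section \<open>Undetectable perturbations\<close>

text \<open>If each element violated one of the two bounds, then \<open>f / a + g / b\<close> would exceed 2 everywhere, while
its mean is at most 2.\<close>

lemma exists_both_le_of_sum_le:
  fixes f g :: "'b \<Rightarrow> real"
  assumes "finite S" "S \<noteq> {}" and "\<And>x. x \<in> S \<Longrightarrow> 0 \<le> f x" "\<And>x. x \<in> S \<Longrightarrow> 0 \<le> g x"
    and "sum f S \<le> real (card S) * a" "sum g S \<le> real (card S) * b" "0 < a" "0 < b"
  shows "\<exists>x\<in>S. f x \<le> 2 * a \<and> g x \<le> 2 * b"
proof (rule ccontr)
  assume neg: "\<not> ?thesis"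
  have "f x / a + g x / b > 2" if x: "x \<in> S" for x
  proof (cases "f x \<le> 2 * a")
    case True
    then have "g x > 2 * b" using neg x by auto
    then have "g x / b > 2" using assms(8) by (simp add: field_simps)
    moreover have "0 \<le> f x / a" using assms(3)[OF x] assms(7) by simp
    ultimately show ?thesis by linarith
  next
    case False
    then have "f x / a > 2" using assms(7) by (simp add: field_simps)
    moreover have "0 \<le> g x / b" using assms(4)[OF x] assms(8) by simp
    ultimately show ?thesis by linarith
  qed
  then have "(\<Sum>x\<in>S. 2) < (\<Sum>x\<in>S. f x / a + g x / b)"
    using assms(1,2) by (intro sum_strict_mono) auto
  also have "\<dots> = sum f S / a + sum g S / b"
    by (simp add: sum.distrib sum_divide_distrib)
  also have "\<dots> \<le> real (card S) + real (card S)"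
    using assms(5-8) by (intro add_mono) (auto simp: field_simps)
  finally show False by simp
qed

text \<open>The likelihood ratios of the perturbed densities with respect to \<open>p0\<close> are those of the abstract mixture
bound, with \<open>v k = u k / p0\<close>; their variances are at most \<open>b / c\<close>, as \<open>u k\<close> lives where \<open>p0 \<ge> c\<close>.
Sobolev energy and rejection probability are controlled on average over the signs, hence simultaneously for one choice of them.\<close>

lemma hard_perturbation_exists:
  fixes p0 :: "'a::euclidean_space \<Rightarrow> real" and u :: "'k \<Rightarrow> 'a \<Rightarrow> real"
  assumes p0: "prob_density p0" and K: "finite K" and c: "c > 0"
    and cont: "\<And>k. k \<in> K \<Longrightarrow> continuous_on UNIV (u k)"
    and int: "\<And>k. k \<in> K \<Longrightarrow> integrable lborel (u k)"
    and bd: "\<And>k x. k \<in> K \<Longrightarrow> \<bar>u k x\<bar> \<le> c"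
    and supp: "\<And>k x. k \<in> K \<Longrightarrow> u k x \<noteq> 0 \<Longrightarrow> c \<le> p0 x"
    and disj: "\<And>k l x. k \<in> K \<Longrightarrow> l \<in> K \<Longrightarrow> k \<noteq> l \<Longrightarrow> u k x * u l x = 0"
    and mean: "\<And>k. k \<in> K \<Longrightarrow> (LINT x|lborel. u k x) = 0"
    and sq: "\<And>k. k \<in> K \<Longrightarrow> (LINT x|lborel. (u k x)\<^sup>2) = b"
    and energy: "\<And>k. k \<in> K \<Longrightarrow> sobolev_energy s (u k) \<le> ennreal e"
    and V: "V > 0" "0 \<le> e" "real (card K) * e \<le> V"
    and test: "is_test n \<psi>" and \<theta>: "\<theta> > 0"
    and rej: "\<theta> / 2 * reject_prob n \<psi> p0 + exp (real (card K) * (real n * (b / c))\<^sup>2 / 2) / (2 * \<theta>) \<le> 1 / 4"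
  shows "\<exists>g. continuous_on UNIV g \<and> integrable lborel g \<and> prob_density (\<lambda>x. p0 x + g x) \<and>
     (\<integral>\<^sup>+ x. ennreal ((g x)\<^sup>2) \<partial>lborel) = ennreal (real (card K) * b) \<and>
     sobolev_energy s g \<le> ennreal (2 * V) \<and> reject_prob n \<psi> (\<lambda>x. p0 x + g x) \<le> 1 / 2"
proof -
  have p0_meas [measurable]: "p0 \<in> borel_measurable borel" and p0_nn: "0 \<le> p0 x"
    and p0_int1: "(\<integral>\<^sup>+ x. ennreal (p0 x) \<partial>lborel) = 1" for x
    using p0 by (auto simp: prob_density_def)
  have u_meas [measurable]: "u k \<in> borel_measurable borel" if "k \<in> K" for k
    using int[OF that] by auto
  define M where "M = density lborel (\<lambda>x. ennreal (p0 x))"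
  have setsM [measurable_cong]: "sets M = sets borel" by (simp add: M_def)
  interpret M: prob_space M
    by (rule prob_spaceI) (simp add: M_def emeasure_density p0_int1 cong: nn_integral_cong)
  define v where "v k x = u k x / p0 x" for k x
  define g where "g A x = (\<Sum>k\<in>K. rademacher A k * u k x)" for A x
  define w where "w A x = 1 + (\<Sum>k\<in>K. rademacher A k * v k x)" for A x
  \<comment> \<open>where \<open>p0\<close> vanishes, \<open>v k\<close> is 0 by division by zero, consistently with \<open>u k\<close>\<close>
  have uz: "u k x = 0" if "k \<in> K" "p0 x = 0" for k x
    using supp[OF that(1), of x] that(2) c by auto
  have v_bd: "\<bar>v k x\<bar> \<le> 1" if "k \<in> K" for k x
    using bd[OF that, of x] supp[OF that, of x] c
    by (cases "u k x = 0") (auto simp: v_def abs_div divide_le_eq_1)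
  have v_meas: "v k \<in> borel_measurable M" if "k \<in> K" for k
    unfolding v_def using that by measurable
  have v_disj: "v k x * v l x = 0" if "k \<in> K" "l \<in> K" "k \<noteq> l" for k l x
    using disj[OF that, of x] by (auto simp: v_def)
  have v_mean: "M.expectation (v k) = 0" if "k \<in> K" for k
  proof -
    have "M.expectation (v k) = (LINT x|lborel. p0 x * v k x)"
      unfolding M_def using that p0_nn v_meas[OF that]
      by (subst integral_density) (auto cong: measurable_cong_sets simp: M_def)
    also have "\<dots> = (LINT x|lborel. u k x)"
      using uz[OF that] by (intro Bochner_Integration.integral_cong) (auto simp: v_def)
    finally show ?thesis using mean[OF that] by simp
  qed
  have u2_int: "integrable lborel (\<lambda>x. (u k x)\<^sup>2)" if "k \<in> K" for k
  proof (rule Bochner_Integration.integrable_bound[where f = "\<lambda>x. c * u k x"])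
    show "integrable lborel (\<lambda>x. c * u k x)" using int[OF that] by simp
    have "\<bar>u k x\<bar> * \<bar>u k x\<bar> \<le> c * \<bar>u k x\<bar>" for x
      using bd[OF that, of x] by (intro mult_right_mono) auto
    then show "AE x in lborel. norm ((u k x)\<^sup>2) \<le> norm (c * u k x)"
      using c by (intro AE_I2) (simp add: power2_eq_square abs_mult)
  qed (use that in measurable)
  have v_var: "M.expectation (\<lambda>x. (v k x)\<^sup>2) \<le> b / c" if "k \<in> K" for k
  proof -
    have le: "p0 x * (v k x)\<^sup>2 \<le> (u k x)\<^sup>2 / c" for x
    proof (cases "u k x = 0")
      case False
      then have "c \<le> p0 x" using supp[OF that] by simp
      moreover have "p0 x * (v k x)\<^sup>2 = (u k x)\<^sup>2 / p0 x"
        using calculation c by (simp add: v_def power2_eq_square)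
      ultimately show ?thesis using c by (auto intro!: divide_left_mono)
    qed (simp add: v_def)
    have "M.expectation (\<lambda>x. (v k x)\<^sup>2) = (LINT x|lborel. p0 x * (v k x)\<^sup>2)"
      unfolding M_def using that p0_nn
      by (subst integral_density) (auto simp: v_def)
    also have "\<dots> \<le> (LINT x|lborel. (u k x)\<^sup>2 / c)"
    proof (rule integral_mono)
      show i: "integrable lborel (\<lambda>x. (u k x)\<^sup>2 / c)" using u2_int[OF that] by simp
      show "integrable lborel (\<lambda>x. p0 x * (v k x)\<^sup>2)"
      proof (rule Bochner_Integration.integrable_bound[OF i])
        show "(\<lambda>x. p0 x * (v k x)\<^sup>2) \<in> borel_measurable lborel"
          unfolding v_def using that by measurable
        show "AE x in lborel. norm (p0 x * (v k x)\<^sup>2) \<le> norm ((u k x)\<^sup>2 / c)"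
          using le p0_nn c by (intro AE_I2) (simp add: abs_mult)
      qed
    qed (rule le)
    also have "\<dots> = b / c" using sq[OF that] by simp
    finally show ?thesis .
  qed
  have pw: "p0 x * w A x = p0 x + g A x" for A x
    using uz by (cases "p0 x = 0") (auto simp: w_def g_def v_def distrib_left sum_distrib_left intro!: sum.neutral sum.cong)
  have w_nn: "0 \<le> w A x" for A x
    unfolding w_def using K v_bd v_disj by (intro one_plus_sum_rademacher_disjoint_nonneg) auto
  have [measurable]: "w A \<in> borel_measurable borel" for A
    unfolding w_def v_def by measurable
  have dens: "density M (\<lambda>x. ennreal (w A x)) = density lborel (\<lambda>x. ennreal (p0 x + g A x))" for A
    unfolding M_def using w_nn p0_nn
    by (subst density_density_eq) (auto simp: ennreal_mult[symmetric] pw)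
  define R where "R = {x \<in> space (\<Pi>\<^sub>M i\<in>{..<n}. (borel :: 'a measure)). \<psi> x}"
  have R: "R \<in> sets (\<Pi>\<^sub>M i\<in>{..<n}. M)"
  proof -
    have "\<psi> -` {True} \<inter> space (\<Pi>\<^sub>M i\<in>{..<n}. (borel :: 'a measure)) \<in> sets (\<Pi>\<^sub>M i\<in>{..<n}. (borel :: 'a measure))"
      using test unfolding is_test_def by (rule measurable_sets) auto
    also have "\<psi> -` {True} \<inter> space (\<Pi>\<^sub>M i\<in>{..<n}. (borel :: 'a measure)) = R"
      by (auto simp: R_def)
    also have "sets (\<Pi>\<^sub>M i\<in>{..<n}. (borel :: 'a measure)) = sets (\<Pi>\<^sub>M i\<in>{..<n}. M)"
      by (intro sets_PiM_cong) (auto simp: setsM)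
    finally show ?thesis .
  qed
  have rejR: "reject_prob n \<psi> p = measure (sample_law n p) R" for p :: "'a \<Rightarrow> real"
    by (simp add: reject_prob_def R_def sample_law_def space_PiM)
  have rejA: "reject_prob n \<psi> (\<lambda>x. p0 x + g A x) = measure (\<Pi>\<^sub>M i\<in>{..<n}. density M (\<lambda>x. ennreal (w A x))) R" for A
    unfolding rejR sample_law_def dens ..
  have rej0: "reject_prob n \<psi> p0 = measure (\<Pi>\<^sub>M i\<in>{..<n}. M) R"
    unfolding rejR sample_law_def M_def ..
  have cardP: "real (card (Pow K)) = 2 ^ card K" using K by (simp add: card_Pow)
  have sum_rej: "(\<Sum>A\<in>Pow K. reject_prob n \<psi> (\<lambda>x. p0 x + g A x)) \<le> real (card (Pow K)) * (1 / 4)"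
  proof -
    have "(\<Sum>A\<in>Pow K. reject_prob n \<psi> (\<lambda>x. p0 x + g A x))
      \<le> 2 ^ card K * (\<theta> / 2 * measure (\<Pi>\<^sub>M i\<in>{..<n}. M) R
           + exp (real (card K) * (real n * (b / c))\<^sup>2 / 2) / (2 * \<theta>))"
      unfolding rejA w_def
      using K v_meas v_bd v_disj v_mean v_var R \<theta> by (rule M.sum_mixture_measure_le)
    also have "\<dots> \<le> 2 ^ card K * (1 / 4)"
      using rej unfolding rej0 by (intro mult_left_mono) auto
    finally show ?thesis unfolding cardP .
  qed
  have sum_en: "(\<Sum>A\<in>Pow K. sobolev_energy s (g A)) \<le> ennreal (real (card (Pow K)) * V)"
  proof -
    have "(\<Sum>A\<in>Pow K. sobolev_energy s (g A)) = ennreal (2 ^ card K) * (\<Sum>k\<in>K. sobolev_energy s (u k))"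
      unfolding g_def using K int by (rule sum_sobolev_energy_rademacher)
    also have "\<dots> \<le> ennreal (2 ^ card K) * (\<Sum>k\<in>K. ennreal e)"
      by (intro mult_left_mono sum_mono energy) auto
    also have "\<dots> = ennreal (2 ^ card K * (real (card K) * e))"
      using V by (simp add: ennreal_mult ennreal_of_nat_eq_real_of_nat)
    also have "\<dots> \<le> ennreal (2 ^ card K * V)"
      using V by (intro ennreal_leI mult_left_mono) auto
    finally show ?thesis unfolding cardP .
  qed
  have en_fin: "sobolev_energy s (g A) = ennreal (enn2real (sobolev_energy s (g A)))" if "A \<in> Pow K" for A
  proof -
    have "sobolev_energy s (g A) \<le> (\<Sum>A\<in>Pow K. sobolev_energy s (g A))"
      using that K by (intro member_le_sum) auto
    also note sum_en
    also have "ennreal (real (card (Pow K)) * V) < \<infinity>" by simp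
    finally show ?thesis by simp
  qed
  have "ennreal (\<Sum>A\<in>Pow K. enn2real (sobolev_energy s (g A))) = (\<Sum>A\<in>Pow K. sobolev_energy s (g A))"
    using en_fin by (subst sum_ennreal[symmetric]) (auto intro!: sum.cong)
  also note sum_en
  finally have sum_en': "(\<Sum>A\<in>Pow K. enn2real (sobolev_energy s (g A))) \<le> real (card (Pow K)) * V"
    using V by (subst (asm) ennreal_le_iff) auto
  have "\<exists>A\<in>Pow K. enn2real (sobolev_energy s (g A)) \<le> 2 * V
      \<and> reject_prob n \<psi> (\<lambda>x. p0 x + g A x) \<le> 2 * (1 / 4)"
    using K V sum_en' sum_rej
    by (intro exists_both_le_of_sum_le) (auto simp: reject_prob_def)
  then obtain A where A: "A \<in> Pow K" "enn2real (sobolev_energy s (g A)) \<le> 2 * V"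
    "reject_prob n \<psi> (\<lambda>x. p0 x + g A x) \<le> 1 / 2" by auto
  show ?thesis
  proof (intro exI[of _ "g A"] conjI)
    show "continuous_on UNIV (g A)"
      unfolding g_def by (intro continuous_intros cont)
    show "integrable lborel (g A)"
      unfolding g_def by (intro Bochner_Integration.integrable_sum integrable_mult_right int)
    show "prob_density (\<lambda>x. p0 x + g A x)"
      unfolding prob_density_def
    proof (intro conjI allI)
      show "(\<lambda>x. p0 x + g A x) \<in> borel_measurable borel" unfolding g_def by measurable
      show "0 \<le> p0 x + g A x" for x
        unfolding pw[symmetric] using p0_nn w_nn by simp
      have "(\<integral>\<^sup>+ x. ennreal (p0 x + g A x) \<partial>lborel) = (\<integral>\<^sup>+ x. ennreal (w A x) \<partial>M)"
        unfolding M_def using p0_nn w_nn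
        by (subst nn_integral_density) (auto simp: ennreal_mult[symmetric] pw)
      also have "\<dots> = 1"
        unfolding w_def using K v_meas v_bd v_disj v_mean by (rule M.expectation_rademacher_products(1))
      finally show "(\<integral>\<^sup>+ x. ennreal (p0 x + g A x) \<partial>lborel) = 1" .
    qed
    have "has_bochner_integral lborel (\<lambda>x. \<Sum>k\<in>K. (u k x)\<^sup>2) (\<Sum>k\<in>K. b)"
      by (intro has_bochner_integral_sum) (auto simp: has_bochner_integral_iff u2_int sq)
    then have "(\<integral>\<^sup>+ x. ennreal (\<Sum>k\<in>K. (u k x)\<^sup>2) \<partial>lborel) = ennreal (\<Sum>k\<in>K. b)"
      by (subst nn_integral_eq_integral) (auto simp: has_bochner_integral_iff sum_nonneg)
    moreover have "(g A x)\<^sup>2 = (\<Sum>k\<in>K. (u k x)\<^sup>2)" for x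
      unfolding g_def power2_eq_square[of "sum _ _"]
      using K disj by (subst sum_rademacher_mult_disjoint) auto
    ultimately show "(\<integral>\<^sup>+ x. ennreal ((g A x)\<^sup>2) \<partial>lborel) = ennreal (real (card K) * b)"
      by simp
    show "sobolev_energy s (g A) \<le> ennreal (2 * V)"
      using A(2) by (subst en_fin[OF A(1)]) (rule ennreal_leI)
    show "reject_prob n \<psi> (\<lambda>x. p0 x + g A x) \<le> 1 / 2" by (rule A(3))
  qed
qed

text \<open>The bumps are copies of \<open>\<phi>\<close> of radius \<open>R * h\<close> centred at the points of a cubic grid with \<open>m\<close> points per
coordinate and spacing \<open>2 * R * h\<close>. The spacing makes the supports disjoint, and the condition on \<open>m\<close>
keeps them in the ball on which \<open>p0 \<ge> c\<close>.\<close>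

lemma grid_perturbation_exists:
  fixes p0 \<phi> :: "real ^ 'd \<Rightarrow> real"
  assumes p0: "prob_density p0" and c: "c > 0" and lower: "\<And>x. dist x0 x < r \<Longrightarrow> c \<le> p0 x"
    and R: "R > 0" and cont: "continuous_on UNIV \<phi>" and bd: "\<And>x. \<bar>\<phi> x\<bar> \<le> 1"
    and supp: "\<And>x. R \<le> norm x \<Longrightarrow> \<phi> x = 0" and mean: "(LINT x|lborel. \<phi> x) = 0"
    and S: "0 \<le> S" "sobolev_energy s \<phi> \<le> ennreal S" and s: "s > 0"
    and h: "0 < h" "h \<le> 1" and \<delta>: "0 < \<delta>" "\<delta> \<le> c"
    and m: "0 < m" "3 * R * h * (real CARD('d) * real m) \<le> r"
    and V: "V > 0" "real m ^ CARD('d) * (\<delta>\<^sup>2 * (h ^ CARD('d) * h powr (- 2 * s)) * S) \<le> V"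
    and test: "is_test n \<psi>" and \<theta>: "\<theta> > 0"
    and rej: "\<theta> / 2 * reject_prob n \<psi> p0 +
       exp (real m ^ CARD('d) * (real n * (\<delta>\<^sup>2 * h ^ CARD('d) * (LINT x|lborel. (\<phi> x)\<^sup>2) / c))\<^sup>2 / 2) / (2 * \<theta>) \<le> 1 / 4"
  shows "\<exists>g. continuous_on UNIV g \<and> integrable lborel g \<and> prob_density (\<lambda>x. p0 x + g x) \<and>
     (\<integral>\<^sup>+ x. ennreal ((g x)\<^sup>2) \<partial>lborel)
        = ennreal (real m ^ CARD('d) * (\<delta>\<^sup>2 * h ^ CARD('d) * (LINT x|lborel. (\<phi> x)\<^sup>2))) \<and>
     sobolev_energy s g \<le> ennreal (2 * V) \<and> reject_prob n \<psi> (\<lambda>x. p0 x + g x) \<le> 1 / 2"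
proof -
  let ?d = "CARD('d)"
  define K where "K = (PiE UNIV (\<lambda>_. {..<m}) :: ('d \<Rightarrow> nat) set)"
  have K: "finite K" unfolding K_def by (intro finite_PiE) auto
  have cardK: "real (card K) = real m ^ ?d" unfolding K_def by (simp add: card_PiE)
  define a where "a k = x0 + (2 * R * h) *\<^sub>R (\<chi> i. real (k i))" for k :: "'d \<Rightarrow> nat"
  define u where "u k x = \<delta> * \<phi> ((x - a k) /\<^sub>R h)" for k x
  have phi_meas [measurable]: "\<phi> \<in> borel_measurable borel"
    using cont by (rule borel_measurable_continuous_onI)
  have phi_int: "integrable lborel \<phi>"
    using bd supp by (intro integrable_compact_support[where B = 1]) auto
  have near: "norm (x - a k) < R * h" if "u k x \<noteq> 0" for k x
  proof -
    have "norm ((x - a k) /\<^sub>R h) < R" using that supp[of "(x - a k) /\<^sub>R h"] by (auto simp: u_def not_le[symmetric])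
    moreover have "norm ((x - a k) /\<^sub>R h) = norm (x - a k) / h"
      using h by (simp add: divide_inverse)
    ultimately show ?thesis using h by (simp add: pos_divide_less_eq)
  qed
  have "\<exists>g. continuous_on UNIV g \<and> integrable lborel g \<and> prob_density (\<lambda>x. p0 x + g x) \<and>
     (\<integral>\<^sup>+ x. ennreal ((g x)\<^sup>2) \<partial>lborel)
        = ennreal (real (card K) * (\<delta>\<^sup>2 * h ^ ?d * (LINT x|lborel. (\<phi> x)\<^sup>2))) \<and>
     sobolev_energy s g \<le> ennreal (2 * V) \<and> reject_prob n \<psi> (\<lambda>x. p0 x + g x) \<le> 1 / 2"
  proof (rule hard_perturbation_exists[where u = u, OF p0 K c])
    show "continuous_on UNIV (u k)" for k
      unfolding u_def by (intro continuous_intros continuous_on_compose2[OF cont]) auto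
    show "integrable lborel (u k)" for k
      using integrable_lborel_affine[OF phi_int, of "inverse h" "- (a k /\<^sub>R h)"] h
      unfolding u_def by (intro integrable_mult_right) (simp add: scaleR_diff_right)
    show "\<bar>u k x\<bar> \<le> c" for k x
      using mult_mono[OF \<delta>(2) bd[of "(x - a k) /\<^sub>R h"]] \<delta> by (simp add: u_def abs_mult)
    show "c \<le> p0 x" if k: "k \<in> K" and ux: "u k x \<noteq> 0" for k x
    proof (rule lower)
      have dm: "1 \<le> real ?d * real m" using m(1) by (simp add: mult_ge1_I Suc_le_eq)
      have "norm (\<chi> i. real (k i)) \<le> (\<Sum>i\<in>UNIV. \<bar>(\<chi> i. real (k i)) $ i\<bar>)"
        by (rule norm_le_l1_cart)
      also have "\<dots> \<le> (\<Sum>i\<in>(UNIV :: 'd set). real m)"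
        using k by (intro sum_mono) (auto simp: K_def PiE_iff less_imp_le)
      finally have kn: "norm (\<chi> i. real (k i)) \<le> real ?d * real m" by simp
      have "dist x0 x = norm ((x - a k) + (2 * R * h) *\<^sub>R (\<chi> i. real (k i)))"
        by (simp add: a_def dist_norm norm_minus_commute)
      also have "\<dots> \<le> norm (x - a k) + 2 * R * h * norm (\<chi> i. real (k i))"
        using R h by (intro order_trans[OF norm_triangle_ineq]) simp
      also have "\<dots> < R * h + 2 * R * h * (real ?d * real m)"
        using near[OF ux] R h kn by (intro add_less_le_mono mult_left_mono) auto
      also have "\<dots> \<le> R * h * (real ?d * real m) + 2 * R * h * (real ?d * real m)"
        using mult_left_mono[OF dm, of "R * h"] R h by (simp only: mult_1_right add_le_cancel_right) simp
      also have "\<dots> \<le> r" using m(2) by (simp add: algebra_simps)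
      finally show "dist x0 x < r" .
    qed
    show "u k x * u l x = 0" if kl: "k \<in> K" "l \<in> K" "k \<noteq> l" for k l x
    proof (rule ccontr)
      assume "u k x * u l x \<noteq> 0"
      then have "norm (x - a k) < R * h" "norm (x - a l) < R * h" by (auto intro!: near)
      then have "norm (a k - a l) < 2 * R * h"
        using norm_triangle_ineq4[of "x - a l" "x - a k"] by simp
      moreover obtain i where i: "k i \<noteq> l i" using kl(3) by auto
      have "2 * R * h * 1 \<le> 2 * R * h * \<bar>real (k i) - real (l i)\<bar>"
        using i R h by (intro mult_left_mono) auto
      also have "\<dots> = \<bar>(a k - a l) $ i\<bar>"
        using R h by (simp add: a_def abs_mult flip: right_diff_distrib)
      also have "\<dots> \<le> norm (a k - a l)" by (rule component_le_norm_cart)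
      ultimately show False by simp
    qed
    have subst: "(LINT x|lborel. f ((x - a k) /\<^sub>R h)) = h ^ ?d * (LINT x|lborel. f x)"
      if "f \<in> borel_measurable borel" for f :: "real ^ 'd \<Rightarrow> real" and k
      using h that by (subst integral_lborel_affine[where h = h and a = "a k"]) auto
    show "(LINT x|lborel. u k x) = 0" for k
      unfolding u_def using subst[of \<phi> k] mean by simp
    show "(LINT x|lborel. (u k x)\<^sup>2) = \<delta>\<^sup>2 * h ^ ?d * (LINT x|lborel. (\<phi> x)\<^sup>2)" for k
      unfolding u_def power_mult_distrib using subst[of "\<lambda>x. (\<phi> x)\<^sup>2" k] by simp
    show "sobolev_energy s (u k) \<le> ennreal (\<delta>\<^sup>2 * (h ^ ?d * h powr (- 2 * s)) * S)" for k
    proof -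
      have "sobolev_energy s (u k) = ennreal (\<delta>\<^sup>2) * sobolev_energy s (\<lambda>x. \<phi> ((x - a k) /\<^sub>R h))"
        unfolding u_def by (rule sobolev_energy_cmult) measurable
      also have "\<dots> \<le> ennreal (\<delta>\<^sup>2) * (ennreal (h ^ DIM(real ^ 'd) * h powr (- 2 * s)) * sobolev_energy s \<phi>)"
        using h s by (intro mult_left_mono sobolev_energy_dilate_le) auto
      also have "\<dots> \<le> ennreal (\<delta>\<^sup>2) * (ennreal (h ^ DIM(real ^ 'd) * h powr (- 2 * s)) * ennreal S)"
        by (intro mult_left_mono S) auto
      also have "\<dots> = ennreal (\<delta>\<^sup>2 * (h ^ ?d * h powr (- 2 * s)) * S)"
        using h S by (simp add: ennreal_mult mult.assoc)
      finally show ?thesis .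
    qed
    show "0 \<le> \<delta>\<^sup>2 * (h ^ ?d * h powr (- 2 * s)) * S" using h S by simp
  qed (use V test \<theta> rej in \<open>simp_all add: cardK\<close>)
  then show ?thesis unfolding cardK .
qed

section \<open>Null density and calibration\<close>

text \<open>A density is positive on a set of positive measure, which must contain a point of continuity.\<close>

lemma density_bounded_below_on_ball:
  fixes p0 :: "'a::euclidean_space \<Rightarrow> real"
  assumes p0: "prob_density p0" and cont: "AE x in lborel. isCont p0 x"
  obtains x0 c r where "c > 0" "r > 0" "\<And>x. dist x0 x < r \<Longrightarrow> c \<le> p0 x"
proof -
  have "\<exists>x0. isCont p0 x0 \<and> 0 < p0 x0"
  proof (rule ccontr)
    assume neg: "\<not> ?thesis"
    have "AE x in lborel. ennreal (p0 x) = 0"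
      using cont by eventually_elim (use neg in \<open>auto simp: not_less ennreal_neg\<close>)
    then have "(\<integral>\<^sup>+ x. ennreal (p0 x) \<partial>lborel) = (\<integral>\<^sup>+ x. 0 \<partial>(lborel :: 'a measure))"
      by (intro nn_integral_cong_AE)
    then show False using p0 by (simp add: prob_density_def)
  qed
  then obtain x0 where x0: "isCont p0 x0" "0 < p0 x0" by blast
  then obtain r where r: "r > 0" "\<And>x. dist x x0 < r \<Longrightarrow> dist (p0 x) (p0 x0) < p0 x0 / 2"
    unfolding continuous_at_eps_delta by (metis half_gt_zero)
  show thesis
  proof (rule that[of "p0 x0 / 2" r x0])
    fix x assume "dist x0 x < r"
    then have "dist (p0 x) (p0 x0) < p0 x0 / 2" by (intro r(2)) (simp add: dist_commute)
    then show "p0 x0 / 2 \<le> p0 x" by (simp add: dist_real_def abs_if split: if_splits)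
  qed (use x0 r in auto)
qed

text \<open>Since the norm of \<open>p0\<close> is strictly below \<open>M\<close>, perturbations of small energy stay in the ball. With
the values of \<open>\<theta>\<close> and \<open>V\<close> below, each of the two terms in \<open>sobolev_energy_add_le\<close> uses up at most half
of the gap between the energy of \<open>p0\<close> and \<open>M\<^sup>2\<close>.\<close>

lemma sobolev_ball_perturbation:
  fixes p0 :: "'a::euclidean_space \<Rightarrow> real"
  assumes p0: "p0 \<in> sobolev s" "sobolev_enorm s p0 < ennreal M" and M: "M > 0"
  obtains V where "V > 0" "\<And>g. continuous_on UNIV g \<Longrightarrow> integrable lborel g \<Longrightarrow>
    sobolev_energy s g \<le> ennreal (2 * V) \<Longrightarrow> (\<lambda>x. p0 x + g x) \<in> sobolev_ball s M"
proof -
  have p0_int: "integrable lborel p0" and p0_cont: "AE x in lborel. isCont p0 x"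
    and fin: "sobolev_energy s p0 < \<infinity>"
    using p0(1) by (auto simp: sobolev_def sobolev_enorm_eq esqrt_less_infinity_iff[unfolded infinity_ennreal_def])
  then obtain E where E: "sobolev_energy s p0 = ennreal E" "0 \<le> E"
    by (cases "sobolev_energy s p0") auto
  have "sqrt E < M"
    using p0(2) E M by (simp add: sobolev_enorm_eq esqrt_ennreal ennreal_less_iff)
  then have EM: "E < M\<^sup>2"
    using real_sqrt_less_iff[of E "M\<^sup>2"] M by simp
  define \<theta> where "\<theta> = (M\<^sup>2 - E) / (2 * (E + 1))"
  have \<theta>: "\<theta> > 0" unfolding \<theta>_def using EM E by simp
  have "\<theta> * E \<le> \<theta> * (E + 1)" using \<theta> by simp
  also have "\<dots> = (M\<^sup>2 - E) / 2" unfolding \<theta>_def using E by (simp add: field_simps)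
  finally have \<theta>E: "(1 + \<theta>) * E \<le> E + (M\<^sup>2 - E) / 2" by (simp add: algebra_simps)
  define V where "V = (M\<^sup>2 - E) / (4 * (1 + 1 / \<theta>))"
  have th1: "1 + 1 / \<theta> > 0" using \<theta> by (simp add: add_pos_pos)
  have V: "V > 0" unfolding V_def using EM th1 by simp
  have VE: "(1 + 1 / \<theta>) * (2 * V) = (M\<^sup>2 - E) / 2"
    unfolding V_def using th1 by (simp add: divide_simps)
  show thesis
  proof (rule that[OF V])
    fix g :: "'a \<Rightarrow> real"
    assume g: "continuous_on UNIV g" "integrable lborel g" "sobolev_energy s g \<le> ennreal (2 * V)"
    have "sobolev_energy s (\<lambda>x. p0 x + g x)
        \<le> ennreal (1 + \<theta>) * sobolev_energy s p0 + ennreal (1 + 1 / \<theta>) * sobolev_energy s g"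
      using p0_int g(2) \<theta> by (rule sobolev_energy_add_le)
    also have "\<dots> \<le> ennreal (1 + \<theta>) * ennreal E + ennreal (1 + 1 / \<theta>) * ennreal (2 * V)"
      unfolding E(1) by (intro add_left_mono mult_left_mono g(3)) auto
    also have "\<dots> = ennreal ((1 + \<theta>) * E + (1 + 1 / \<theta>) * (2 * V))"
      using \<theta> th1 V E by (simp add: ennreal_mult)
    also have "\<dots> \<le> ennreal (M\<^sup>2)"
    proof (intro ennreal_leI)
      have "E + (M\<^sup>2 - E) / 2 + (M\<^sup>2 - E) / 2 = M\<^sup>2" by simp
      then show "(1 + \<theta>) * E + (1 + 1 / \<theta>) * (2 * V) \<le> M\<^sup>2"
        using \<theta>E unfolding VE by linarith
    qed
    finally have le: "sobolev_energy s (\<lambda>x. p0 x + g x) \<le> ennreal (M\<^sup>2)" .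
    then have norm_le: "sobolev_enorm s (\<lambda>x. p0 x + g x) \<le> ennreal M"
      unfolding sobolev_enorm_eq using M by (intro esqrt_le_ennreal) auto
    also have "\<dots> < \<infinity>" by simp
    finally have norm_fin: "sobolev_enorm s (\<lambda>x. p0 x + g x) < \<infinity>" .
    have "AE x in lborel. isCont (\<lambda>x. p0 x + g x) x"
      using p0_cont
    proof eventually_elim
      case (elim x)
      moreover have "isCont g x" using g(1) by (simp add: continuous_on_eq_continuous_at)
      ultimately show ?case by (intro continuous_add)
    qed
    then show "(\<lambda>x. p0 x + g x) \<in> sobolev_ball s M"
      using norm_le norm_fin p0_int g(2) by (simp add: sobolev_ball_def sobolev_def)
  qed
qed

text \<open>Solving the constraints on the number \<open>m\<close> of bumps per coordinate and their height \<open>\<delta>\<close>. The height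
\<open>D * q powr (- s)\<close> is dictated by the \<open>L\<^sub>2\<close> distance. A small \<open>\<tau>\<close> in \<open>m = \<lfloor>\<tau> * q\<rfloor>\<close>, that is, wide bumps,
makes the Sobolev energy small. The exponent of the second moment is then at most a constant times
\<open>n\<^sup>2 * q powr (- (d + 4 * s))\<close>, and \<open>q\<close> is chosen to make this product equal to 1.\<close>

lemma separation_rate_calibration:
  fixes s C \<rho> A S V c :: real and d :: nat
  assumes s: "s > 0" and C: "C > 0" and \<rho>: "\<rho> > 0" and A: "A > 0" and S: "S \<ge> 0"
    and V: "V > 0" and c: "c > 0"
  obtains \<kappa> where "\<kappa> \<ge> 0"
    "\<forall>\<^sub>F n in sequentially. \<exists>m \<delta>. 0 < m \<and> 0 < \<delta> \<and> \<delta> \<le> c \<and>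
       real m ^ d * (\<delta>\<^sup>2 * ((\<rho> / real m) ^ d * (\<rho> / real m) powr (- 2 * s)) * S) \<le> V \<and>
       (C / real n powr (2 * s / (real d + 4 * s)))\<^sup>2 \<le> real m ^ d * (\<delta>\<^sup>2 * (\<rho> / real m) ^ d * A) \<and>
       real m ^ d * (real n * (\<delta>\<^sup>2 * (\<rho> / real m) ^ d * A / c))\<^sup>2 / 2 \<le> \<kappa>"
proof -
  define D where "D = C / sqrt (\<rho> ^ d * A)"
  have D: "D > 0" unfolding D_def using C \<rho> A by simp
  have D2: "D\<^sup>2 * (\<rho> ^ d * A) = C\<^sup>2" unfolding D_def using \<rho> A by (simp add: power_divide)
  define E where "E = D\<^sup>2 * (\<rho> ^ d * \<rho> powr (- 2 * s)) * S + 1"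
  have E: "E \<ge> 1" unfolding E_def using S \<rho> by simp
  define \<tau> where "\<tau> = (V / E) powr (1 / (2 * s))"
  have \<tau>: "\<tau> > 0" unfolding \<tau>_def using V E by simp
  have \<tau>s: "\<tau> powr (2 * s) = V / E"
    unfolding \<tau>_def using V E s by (simp add: powr_powr)
  define q where "q n = real n powr (2 / (real d + 4 * s))" for n :: nat
  have ds: "real d + 4 * s > 0" using s by (simp add: add_nonneg_pos)
  define \<kappa> where "\<kappa> = D ^ 4 * (\<rho> ^ d)\<^sup>2 * A\<^sup>2 * (2 / \<tau>) ^ d / c\<^sup>2 / 2"
  have \<kappa>: "\<kappa> \<ge> 0" unfolding \<kappa>_def using D \<rho> A \<tau> c by simp
  have q_lim: "filterlim q at_top sequentially"
  proof -
    have "((\<lambda>n. real n powr - (2 / (real d + 4 * s))) \<longlongrightarrow> 0) sequentially"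
      using ds by (intro tendsto_neg_powr filterlim_real_sequentially) simp
    then have "filterlim (\<lambda>n. inverse (real n powr - (2 / (real d + 4 * s)))) at_top sequentially"
      by (rule filterlim_inverse_at_top)
         (use eventually_gt_at_top[of 0] in eventually_elim, simp)
    then show ?thesis by (simp add: q_def[abs_def] powr_minus)
  qed
  have ev1: "\<forall>\<^sub>F n in sequentially. 2 / \<tau> \<le> q n"
    using q_lim by (simp add: filterlim_at_top)
  have "((\<lambda>n. D * q n powr (- s)) \<longlongrightarrow> D * 0) sequentially"
    using s by (intro tendsto_mult tendsto_const tendsto_neg_powr q_lim) auto
  then have ev2: "\<forall>\<^sub>F n in sequentially. D * q n powr (- s) < c"
    using c by (intro order_tendstoD(2)) auto
  show thesis
  proof (rule that[OF \<kappa>])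
    show "\<forall>\<^sub>F n in sequentially. \<exists>m \<delta>. 0 < m \<and> 0 < \<delta> \<and> \<delta> \<le> c \<and>
       real m ^ d * (\<delta>\<^sup>2 * ((\<rho> / real m) ^ d * (\<rho> / real m) powr (- 2 * s)) * S) \<le> V \<and>
       (C / real n powr (2 * s / (real d + 4 * s)))\<^sup>2 \<le> real m ^ d * (\<delta>\<^sup>2 * (\<rho> / real m) ^ d * A) \<and>
       real m ^ d * (real n * (\<delta>\<^sup>2 * (\<rho> / real m) ^ d * A / c))\<^sup>2 / 2 \<le> \<kappa>"
      using ev1 ev2 eventually_gt_at_top[of 0]
    proof eventually_elim
      case (elim n)
      define Q where "Q = q n"
      define m where "m = nat \<lfloor>\<tau> * Q\<rfloor>"
      define \<delta> where "\<delta> = D * Q powr (- s)"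
      have Q0: "Q > 0" unfolding Q_def q_def using elim(3) by simp
      have tQ: "2 \<le> \<tau> * Q" using elim(1) \<tau> by (simp add: Q_def field_simps)
      have m_le: "real m \<le> \<tau> * Q" unfolding m_def using tQ by (simp add: of_nat_nat)
      have m_ge: "\<tau> * Q / 2 \<le> real m" unfolding m_def using tQ by linarith
      have m0: "0 < m" using m_ge tQ by (cases m) auto
      have \<delta>0: "0 < \<delta>" unfolding \<delta>_def using D Q0 by simp
      have md: "real m ^ d * (\<rho> / real m) ^ d = \<rho> ^ d"
        using m0 by (simp add: power_divide)
      have Qsq: "(Q powr a)\<^sup>2 = Q powr (2 * a)" for a
        using powr_add[of Q a a] by (simp add: power2_eq_square)
      have \<delta>2: "\<delta>\<^sup>2 = D\<^sup>2 * Q powr (- 2 * s)"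
        unfolding \<delta>_def by (simp add: power_mult_distrib Qsq)
      have pw: "(\<rho> / real m) powr (- 2 * s) = \<rho> powr (- 2 * s) * real m powr (2 * s)"
        using \<rho> m0 by (simp add: powr_divide powr_minus field_simps)
      have "real m ^ d * (\<delta>\<^sup>2 * ((\<rho> / real m) ^ d * (\<rho> / real m) powr (- 2 * s)) * S)
          = D\<^sup>2 * (\<rho> ^ d * \<rho> powr (- 2 * s)) * S * (Q powr (- 2 * s) * real m powr (2 * s))"
        unfolding pw \<delta>2 md[symmetric] by (simp only: mult_ac)
      also have "\<dots> \<le> E * (Q powr (- 2 * s) * (\<tau> * Q) powr (2 * s))"
      proof (intro mult_mono mult_left_mono)
        show "real m powr (2 * s) \<le> (\<tau> * Q) powr (2 * s)"
          using s m_le by (intro powr_mono2) auto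
      qed (use E in \<open>auto simp: E_def\<close>)
      also have "(\<tau> * Q) powr (2 * s) = \<tau> powr (2 * s) * Q powr (2 * s)"
        using \<tau> Q0 by (simp add: powr_mult)
      also have "E * (Q powr (- 2 * s) * (\<tau> powr (2 * s) * Q powr (2 * s))) = V"
        using Q0 E unfolding \<tau>s by (simp add: powr_minus)
      finally have sob: "real m ^ d * (\<delta>\<^sup>2 * ((\<rho> / real m) ^ d * (\<rho> / real m) powr (- 2 * s)) * S) \<le> V" .
      have "real n powr (2 * s / (real d + 4 * s)) = Q powr s"
        unfolding Q_def q_def by (simp add: powr_powr)
      then have "(C / real n powr (2 * s / (real d + 4 * s)))\<^sup>2 = C\<^sup>2 * Q powr (- 2 * s)"
        by (simp add: power_divide Qsq powr_minus_divide)
      also have "\<dots> = real m ^ d * (\<delta>\<^sup>2 * (\<rho> / real m) ^ d * A)"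
        unfolding D2[symmetric] \<delta>2 md[symmetric] by (simp only: mult_ac)
      finally have l2: "(C / real n powr (2 * s / (real d + 4 * s)))\<^sup>2 \<le> real m ^ d * (\<delta>\<^sup>2 * (\<rho> / real m) ^ d * A)"
        by simp
      \<comment> \<open>the balance between sample size and number of bumps that determines the rate\<close>
      have nQ: "(real n)\<^sup>2 = Q ^ d * Q powr (4 * s)"
      proof -
        have "Q ^ d * Q powr (4 * s) = Q powr (real d + 4 * s)"
          using Q0 by (simp add: powr_add powr_realpow)
        also have "\<dots> = real n powr 2"
        proof -
          have "2 / X * X = 2" if "X > 0" for X :: real using that by simp
          from this[OF ds] show ?thesis unfolding Q_def q_def powr_powr by (simp only:)
        qed
        also have "\<dots> = (real n)\<^sup>2" using elim(3) by simp
        finally show ?thesis ..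
      qed
      have \<delta>4: "(\<delta>\<^sup>2)\<^sup>2 = D ^ 4 * Q powr (- 4 * s)"
        unfolding \<delta>2 power_mult_distrib Qsq by (simp flip: power_mult)
      have "real m ^ d * (real n * (\<delta>\<^sup>2 * (\<rho> / real m) ^ d * A / c))\<^sup>2
         = (real m ^ d * ((\<rho> / real m) ^ d)\<^sup>2) * (real n)\<^sup>2 * (\<delta>\<^sup>2)\<^sup>2 * A\<^sup>2 / c\<^sup>2"
        by (simp add: power_mult_distrib power_divide mult.assoc mult.left_commute mult.commute)
      also have "real m ^ d * ((\<rho> / real m) ^ d)\<^sup>2 = (\<rho> ^ d)\<^sup>2 * (1 / real m) ^ d"
        using m0 by (simp add: power_divide power2_eq_square)
      also have "(\<rho> ^ d)\<^sup>2 * (1 / real m) ^ d * (real n)\<^sup>2 * (\<delta>\<^sup>2)\<^sup>2 * A\<^sup>2 / c\<^sup>2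
         = (D ^ 4 * (\<rho> ^ d)\<^sup>2 * A\<^sup>2) * (Q / real m) ^ d * (Q powr (4 * s) * Q powr (- 4 * s)) / c\<^sup>2"
        unfolding nQ \<delta>4 by (simp add: power_divide mult_ac)
      also have "Q powr (4 * s) * Q powr (- 4 * s) = 1"
        using Q0 by (simp flip: powr_add)
      also have "(D ^ 4 * (\<rho> ^ d)\<^sup>2 * A\<^sup>2) * (Q / real m) ^ d * 1 / c\<^sup>2
         \<le> (D ^ 4 * (\<rho> ^ d)\<^sup>2 * A\<^sup>2) * (2 / \<tau>) ^ d / c\<^sup>2"
      proof -
        have "Q / real m \<le> 2 / \<tau>" using m_ge m0 \<tau> by (simp add: field_simps)
        then have "(Q / real m) ^ d \<le> (2 / \<tau>) ^ d" using Q0 by (intro power_mono) auto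
        then show ?thesis by (simp add: divide_right_mono mult_left_mono)
      qed
      finally have "real m ^ d * (real n * (\<delta>\<^sup>2 * (\<rho> / real m) ^ d * A / c))\<^sup>2 / 2 \<le> \<kappa>"
        unfolding \<kappa>_def by simp
      then show ?case
        using m0 \<delta>0 elim(2) sob l2 by (intro exI[of _ m] exI[of _ \<delta>]) (auto simp: \<delta>_def Q_def)
    qed
  qed
qed

section \<open>Lower bound for the separation rate\<close>

theorem theorem3:
  fixes s M :: real and p0 :: "real ^ 'd \<Rightarrow> real" and \<Delta> :: "nat \<Rightarrow> real"
  assumes "s > 0" and "M > 0"
    and "prob_density p0" and "p0 \<in> sobolev s" and "sobolev_enorm s p0 < ennreal M"
    and "\<And>n. \<Delta> n > 0"
    and "liminf (\<lambda>n. ereal (real n powr (2 * s / (real CARD('d) + 4 * s)) * \<Delta> n)) < \<infinity>"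
  shows "\<exists>\<alpha>. 0 < \<alpha> \<and> \<alpha> < 1 \<and>
    (\<forall>\<Phi> :: nat \<Rightarrow> (nat \<Rightarrow> real ^ 'd) \<Rightarrow> bool.
       (\<forall>n. is_test n (\<Phi> n)) \<and> asymptotic_level \<Phi> p0 \<alpha> \<longrightarrow>
       liminf (\<lambda>n. gof_power n (\<Phi> n) (gof_alternative s M p0 (\<Delta> n))) < 1)"
proof -
  let ?d = "CARD('d)"
  let ?rate = "\<lambda>n. real n powr (2 * s / (real ?d + 4 * s))"
  have "AE x in lborel. isCont p0 x" using assms(4) by (simp add: sobolev_def)
  with assms(3) obtain x0 c r where c: "c > 0" and r: "r > 0"
    and lower: "\<And>x. dist x0 x < r \<Longrightarrow> c \<le> p0 x"
    by (rule density_bounded_below_on_ball) blast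
  obtain V where V: "V > 0" and room: "\<And>g. continuous_on UNIV g \<Longrightarrow> integrable lborel g \<Longrightarrow>
      sobolev_energy s g \<le> ennreal (2 * V) \<Longrightarrow> (\<lambda>x. p0 x + g x) \<in> sobolev_ball s M"
    using sobolev_ball_perturbation[OF assms(4,5,2)] by blast
  obtain \<phi> :: "real ^ 'd \<Rightarrow> real" and R where R: "R > 0" and phi: "continuous_on UNIV \<phi>"
    "\<And>x. \<bar>\<phi> x\<bar> \<le> 1" "\<And>x. R \<le> norm x \<Longrightarrow> \<phi> x = 0" "(LINT x|lborel. \<phi> x) = 0"
    and A: "0 < (LINT x|lborel. (\<phi> x)\<^sup>2)" and fin: "sobolev_energy s \<phi> < \<infinity>"
    by (rule wavelet_exists[OF assms(1), where 'a = "real ^ 'd"]) (rule that)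
  define S where "S = enn2real (sobolev_energy s \<phi>)"
  have S: "0 \<le> S" "sobolev_energy s \<phi> \<le> ennreal S" using fin by (auto simp: S_def)
  define \<rho> where "\<rho> = min 1 (r / (3 * R * real ?d))"
  have \<rho>: "\<rho> > 0" "\<rho> \<le> 1" "3 * R * \<rho> * real ?d \<le> r"
  proof -
    have "\<rho> \<le> r / (3 * R * real ?d)" unfolding \<rho>_def by simp
    then show "3 * R * \<rho> * real ?d \<le> r" using R by (simp add: field_simps)
  qed (use r R in \<open>auto simp: \<rho>_def\<close>)
  obtain N where N: "liminf (\<lambda>n. ereal (?rate n * \<Delta> n)) < ereal (real N)"
    using assms(7) less_PInf_Ex_of_nat by auto
  \<comment> \<open>the summand 1 makes the constant positive\<close>
  define C where "C = real N + 1"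
  have C: "C > 0" unfolding C_def by simp
  have freq: "\<exists>\<^sub>F n in sequentially. ?rate n * \<Delta> n \<le> C"
  proof (rule ccontr)
    assume "\<not> ?thesis"
    then have "\<forall>\<^sub>F n in sequentially. ereal (real N) \<le> ereal (?rate n * \<Delta> n)"
      unfolding not_frequently by eventually_elim (auto simp: C_def)
    then have "ereal (real N) \<le> liminf (\<lambda>n. ereal (?rate n * \<Delta> n))"
      by (rule Liminf_bounded)
    with N show False by simp
  qed
  obtain \<kappa> where \<kappa>: "\<kappa> \<ge> 0" and cal: "\<forall>\<^sub>F n in sequentially. \<exists>m \<delta>. 0 < m \<and> 0 < \<delta> \<and> \<delta> \<le> c \<and>
       real m ^ ?d * (\<delta>\<^sup>2 * ((\<rho> / real m) ^ ?d * (\<rho> / real m) powr (- 2 * s)) * S) \<le> V \<and>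
       (C / ?rate n)\<^sup>2 \<le> real m ^ ?d * (\<delta>\<^sup>2 * (\<rho> / real m) ^ ?d * (LINT x|lborel. (\<phi> x)\<^sup>2)) \<and>
       real m ^ ?d * (real n * (\<delta>\<^sup>2 * (\<rho> / real m) ^ ?d * (LINT x|lborel. (\<phi> x)\<^sup>2) / c))\<^sup>2 / 2 \<le> \<kappa>"
    using separation_rate_calibration[OF assms(1) C \<rho>(1) A S(1) V c, of ?d] by blast
  define E where "E = exp \<kappa>"
  have E: "E \<ge> 1" unfolding E_def using \<kappa> by simp
  \<comment> \<open>half of the bound \<open>1 / (16 * E)\<close> on the size of the test that the case \<open>\<theta> = 4 * E\<close> of the mixture
     bound needs; the factor 2 absorbs the passage from the limit superior to finite \<open>n\<close>\<close>
  define \<alpha> where "\<alpha> = 1 / (32 * E)"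
  show ?thesis
  proof (intro exI[of _ \<alpha>] conjI allI impI)
    show "0 < \<alpha>" "\<alpha> < 1" unfolding \<alpha>_def using E by auto
    fix \<Phi> :: "nat \<Rightarrow> (nat \<Rightarrow> real ^ 'd) \<Rightarrow> bool"
    assume "(\<forall>n. is_test n (\<Phi> n)) \<and> asymptotic_level \<Phi> p0 \<alpha>"
    then have test: "\<And>n. is_test n (\<Phi> n)" and level: "limsup (\<lambda>n. ereal (reject_prob n (\<Phi> n) p0)) \<le> ereal \<alpha>"
      by (auto simp: asymptotic_level_def)
    note level
    also have "ereal \<alpha> < ereal (1 / (16 * E))" unfolding \<alpha>_def using E by (simp add: field_simps)
    finally have "\<forall>\<^sub>F n in sequentially. ereal (reject_prob n (\<Phi> n) p0) < ereal (1 / (16 * E))"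
      by (rule Limsup_lessD)
    then have lev: "\<forall>\<^sub>F n in sequentially. reject_prob n (\<Phi> n) p0 < 1 / (16 * E)" by simp
    have ev: "\<forall>\<^sub>F n in sequentially. ?rate n * \<Delta> n \<le> C \<longrightarrow>
        gof_power n (\<Phi> n) (gof_alternative s M p0 (\<Delta> n)) \<le> ereal (1 / 2)"
      using cal lev eventually_gt_at_top[of 0]
    proof eventually_elim
      case (elim n)
      show ?case
      proof
        assume \<Delta>C: "?rate n * \<Delta> n \<le> C"
        obtain m \<delta> where m: "0 < m" and \<delta>: "0 < \<delta>" "\<delta> \<le> c"
          and sob: "real m ^ ?d * (\<delta>\<^sup>2 * ((\<rho> / real m) ^ ?d * (\<rho> / real m) powr (- 2 * s)) * S) \<le> V"
          and l2: "(C / ?rate n)\<^sup>2 \<le> real m ^ ?d * (\<delta>\<^sup>2 * (\<rho> / real m) ^ ?d * (LINT x|lborel. (\<phi> x)\<^sup>2))"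
          and chi: "real m ^ ?d * (real n * (\<delta>\<^sup>2 * (\<rho> / real m) ^ ?d * (LINT x|lborel. (\<phi> x)\<^sup>2) / c))\<^sup>2 / 2 \<le> \<kappa>"
            (is "?chi \<le> \<kappa>")
          using elim(1) by blast
        define h where "h = \<rho> / real m"
        have h: "0 < h" "h \<le> 1" "3 * R * h * (real ?d * real m) \<le> r"
          using \<rho> m by (auto simp: h_def field_simps)
        have rej: "4 * E / 2 * reject_prob n (\<Phi> n) p0 + exp ?chi / (2 * (4 * E)) \<le> 1 / 4"
        proof -
          have "4 * E / 2 * reject_prob n (\<Phi> n) p0 \<le> 4 * E / 2 * (1 / (16 * E))"
            using elim(2) E by (intro mult_left_mono) auto
          moreover have "exp ?chi / (2 * (4 * E)) \<le> E / (2 * (4 * E))"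
            using chi E by (intro divide_right_mono) (auto simp: E_def)
          moreover have "4 * E / 2 * (1 / (16 * E)) = 1 / 8" "E / (2 * (4 * E)) = 1 / 8"
            using E by simp_all
          ultimately show ?thesis by linarith
        qed
        have "0 < 4 * E" using E by simp
        have "\<exists>g. continuous_on UNIV g \<and> integrable lborel g \<and> prob_density (\<lambda>x. p0 x + g x) \<and>
           (\<integral>\<^sup>+ x. ennreal ((g x)\<^sup>2) \<partial>lborel)
              = ennreal (real m ^ ?d * (\<delta>\<^sup>2 * h ^ ?d * (LINT x|lborel. (\<phi> x)\<^sup>2))) \<and>
           sobolev_energy s g \<le> ennreal (2 * V) \<and> reject_prob n (\<Phi> n) (\<lambda>x. p0 x + g x) \<le> 1 / 2"
          using assms(3) c lower R phi S assms(1) h(1,2) \<delta> m h(3) V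
            sob[folded h_def] test \<open>0 < 4 * E\<close> rej[folded h_def]
          by (rule grid_perturbation_exists)
        then obtain g where g: "continuous_on UNIV g" "integrable lborel g"
            "prob_density (\<lambda>x. p0 x + g x)" "sobolev_energy s g \<le> ennreal (2 * V)"
            "reject_prob n (\<Phi> n) (\<lambda>x. p0 x + g x) \<le> 1 / 2"
          and g2: "(\<integral>\<^sup>+ x. ennreal ((g x)\<^sup>2) \<partial>lborel)
              = ennreal (real m ^ ?d * (\<delta>\<^sup>2 * h ^ ?d * (LINT x|lborel. (\<phi> x)\<^sup>2)))"
          by blast
        have "\<Delta> n \<le> C / ?rate n" using \<Delta>C elim(3) by (simp add: field_simps)
        also have "\<dots> \<le> sqrt (real m ^ ?d * (\<delta>\<^sup>2 * h ^ ?d * (LINT x|lborel. (\<phi> x)\<^sup>2)))"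
          using l2[folded h_def] by (rule real_le_rsqrt)
        finally have "ennreal (\<Delta> n) \<le> L2_enorm g"
          unfolding L2_enorm_def g2 using h A by (subst esqrt_ennreal) (auto intro!: ennreal_leI)
        then have "(\<lambda>x. p0 x + g x) \<in> gof_alternative s M p0 (\<Delta> n)"
          using room[OF g(1,2,4)] g(3) by (simp add: gof_alternative_def)
        then have "gof_power n (\<Phi> n) (gof_alternative s M p0 (\<Delta> n))
            \<le> ereal (reject_prob n (\<Phi> n) (\<lambda>x. p0 x + g x))"
          unfolding gof_power_def by (rule INF_lower)
        also have "\<dots> \<le> ereal (1 / 2)" using g(5) by simp
        finally show "gof_power n (\<Phi> n) (gof_alternative s M p0 (\<Delta> n)) \<le> ereal (1 / 2)" .
      qed
    qed
    show "liminf (\<lambda>n. gof_power n (\<Phi> n) (gof_alternative s M p0 (\<Delta> n))) < 1"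
    proof (rule ccontr)
      assume "\<not> ?thesis"
      then have "1 \<le> liminf (\<lambda>n. gof_power n (\<Phi> n) (gof_alternative s M p0 (\<Delta> n)))"
        by (simp only: not_less)
      moreover have "ereal (1 / 2) < 1" by (simp add: one_ereal_def)
      ultimately have "ereal (1 / 2) < liminf (\<lambda>n. gof_power n (\<Phi> n) (gof_alternative s M p0 (\<Delta> n)))"
        by (rule less_le_trans[rotated])
      then have "\<forall>\<^sub>F n in sequentially. ereal (1 / 2) < gof_power n (\<Phi> n) (gof_alternative s M p0 (\<Delta> n))"
        by (rule less_LiminfD)
      with ev have "\<forall>\<^sub>F n in sequentially. \<not> ?rate n * \<Delta> n \<le> C"
        by eventually_elim auto
      then show False using freq by (simp add: frequently_def)
    qed
  qed
qed

end
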